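(* For any finite vertex-transitive graph $G$ (with simple random walk transition matrix $M$ and random environment matrix $B$ satisfying the assumptions in the context) and all $f,g\in\mathcal X$ we have $$\mathbf E\,T_G(f)=0,\qquad \mathbf E\,[T_G(f)\,T_G(g)]=H_G(f,g).$$
   Context: Assumptions. $G$ is a vertex-transitive graph of finite degree; $M$ is the transition probability matrix of nearest-neighbor simple random walk on $G$. $B=(B_{u,v})_{u,v\in G}$ is a random matrix such that: (i) for every edge $uv$, $B_{u,v}$ has mean $0$ and variance $1$; (ii) the $B_{u,v}$'s corresponding to different $u$ are independent (i.e. the rows of $B$ are independent); (iii) there is a constant $c_1$ with $|B_{u,v}|\le c_1M_{u,v}$ for all vertices $u,v$ (so $B_{u,v}=0$ if $uv$ is not an edge); (iv) for all $u,v$, $\sum_{g\in \mathrm{Stab}(u)}B_{u,gv}=0$, where $\mathrm{Stab}(u)$ is the stabilizer of $u$ in the automorphism group of $G$. $\mathcal X$ is the space of complex functions analytic in a neighborhood of the closed unit disk. For finite $G$, $\mu_\varepsilon$ is the empirical probability measure of the eigenvalues of $M+\varepsilon B$, $m_\varepsilon=|G|^{1/2}(\mu_\varepsilon-\mu_0)/\varepsilon^2$, and $T_G(f)=\lim_{\varepsilon\to0}\int f\,dm_\varepsilon$ for $f\in\mathcal X$ (this limit exists). Fix a vertex $o$ of $G$. For vertices $v,w$ and $j\ge 0$ put $Y_j(G,v,w)=\sum_{j_1+j_2+2=j}(BM^{j_1})_{v,w}(BM^{j_2})_{w,v}$ (sum over integers $j_1,j_2\ge0$), $\alpha_{ij}=\mathbf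 E\big[\sum_{v\in G\setminus\{o\}}Y_i(G,o,v)Y_j(G,o,v)\big]$, and for $f,g\in\mathcal X$ $$H_G(f,g)=\frac12\sum_{i,j}ij\,\alpha_{ij}\,[x^i]f(x)\,[x^j]g(x),$$ where $[x^k]f(x)$ is the coefficient of $x^k$ in the power series of $f$ at $0$ (the series converges absolutely).
   Formalization: The second identity is proved under an added assumption: automorphisms acting transitively on the vertices preserve the covariances within rows of B. Without it α_ij can depend on o and the identity fails (e.g. on the octahedron with f=g=x^3). *)

theory Defs
  imports "HOL-Probability.Probability" "HOL-Complex_Analysis.Complex_Analysis"
begin

definition automorphisms :: "('v \<Rightarrow> 'v \<Rightarrow> bool) \<Rightarrow> ('v \<Rightarrow> 'v) set" where
  "automorphisms adj = {\<pi>. bij \<pi> \<and> (\<forall>u v. adj (\<pi> u) (\<pi> v) \<longleftrightarrow> adj u v)}"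

definition stabilizer :: "('v \<Rightarrow> 'v \<Rightarrow> bool) \<Rightarrow> 'v \<Rightarrow> ('v \<Rightarrow> 'v) set" where
  "stabilizer adj u = {\<pi> \<in> automorphisms adj. \<pi> u = u}"

locale vertex_transitive_graph =
  fixes adj :: "'v::finite \<Rightarrow> 'v \<Rightarrow> bool"
  assumes adj_sym: "adj u v \<Longrightarrow> adj v u"
    and adj_irrefl: "\<not> adj u u"
    and transitive: "\<exists>\<pi> \<in> automorphisms adj. \<pi> u = v"

definition walk_matrix :: "('v::finite \<Rightarrow> 'v \<Rightarrow> bool) \<Rightarrow> real^'v^'v" where
  "walk_matrix adj = (\<chi> u v. if adj u v then 1 / real (card {w. adj u w}) else 0)"

locale random_environment = vertex_transitive_graph adj + prob_space P
  for adj :: "'v::finite \<Rightarrow> 'v \<Rightarrow> bool" and P :: "'w measure" +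
  fixes B :: "'w \<Rightarrow> real^'v^'v"
  assumes mean_zero: "adj u v \<Longrightarrow> expectation (\<lambda>\<omega>. B \<omega> $ u $ v) = 0"
    and variance_one: "adj u v \<Longrightarrow> variance (\<lambda>\<omega>. B \<omega> $ u $ v) = 1"
    and indep_rows: "indep_vars (\<lambda>_. borel) (\<lambda>u \<omega>. B \<omega> $ u) UNIV"
    and bounded: "\<exists>c1::real. AE \<omega> in P. \<forall>u v. \<bar>B \<omega> $ u $ v\<bar> \<le> c1 * walk_matrix adj $ u $ v"
    and stabilizer_sum: "AE \<omega> in P. \<forall>u v. (\<Sum>\<pi> \<in> stabilizer adj u. B \<omega> $ u $ \<pi> v) = 0"

text \<open>
  The assumptions of \<^locale>\<open>random_environment\<close> fix the mean and the variance of each entry, but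
  not the covariances inside a row, and those may differ from row to row. The following condition
  says that, for the covariances (equivalently, as all entries are centred, for the second
  moments), the rows at any two vertices look alike. It holds in particular if the law of
  \<open>B\<close> is invariant under a transitive group of automorphisms. Without it the quantity
  \<open>alpha\<close> below can depend on the choice of the base vertex.
\<close>

definition homogeneous_covariances ::
    "('v::finite \<Rightarrow> 'v \<Rightarrow> bool) \<Rightarrow> 'w measure \<Rightarrow> ('w \<Rightarrow> real^'v^'v) \<Rightarrow> bool" where
  "homogeneous_covariances adj P B \<longleftrightarrow>
    (\<forall>u v. \<exists>\<pi> \<in> automorphisms adj. \<pi> u = v \<and>
      (\<forall>x y z. (\<integral>\<omega>. B \<omega> $ \<pi> x $ \<pi> y * B \<omega> $ \<pi> x $ \<pi> z \<partial>P)
              = (\<integral>\<omega>. B \<omega> $ x $ y * B \<omega> $ x $ z \<partial>P)))"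

definition char_polynomial :: "'a::comm_ring_1^'n^'n \<Rightarrow> 'a poly" where
  "char_polynomial A = det (mat [:0, 1:] - (\<chi> i j. [:A $ i $ j:]))"

text \<open>Eigenvalues are counted with algebraic multiplicity.\<close>

definition eigenvalue_distribution :: "complex^'n^'n \<Rightarrow> complex pmf" where
  "eigenvalue_distribution A = pmf_of_multiset (proots (char_polynomial A))"

definition perturbed_matrix :: "real^'n^'n \<Rightarrow> real^'n^'n \<Rightarrow> real \<Rightarrow> complex^'n^'n" where
  "perturbed_matrix M A \<epsilon> = (\<chi> u v. complex_of_real (M $ u $ v + \<epsilon> * A $ u $ v))"

text \<open>
  The integral of \<open>f\<close> against the signed measure \<open>sqrt \<bar>G\<bar> (\<mu>\<^sub>\<epsilon> - \<mu>\<^sub>0) / \<epsilon>\<^sup>2\<close>, and its limit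
  as \<open>\<epsilon>\<close> tends to 0. The argument \<open>A\<close> is a realization of the random matrix.
\<close>

definition spectral_fluctuation ::
    "('v::finite \<Rightarrow> 'v \<Rightarrow> bool) \<Rightarrow> real^'v^'v \<Rightarrow> (complex \<Rightarrow> complex) \<Rightarrow> real \<Rightarrow> complex" where
  "spectral_fluctuation adj A f \<epsilon> =
    complex_of_real (sqrt (real CARD('v))) *
      (measure_pmf.expectation (eigenvalue_distribution (perturbed_matrix (walk_matrix adj) A \<epsilon>)) f
       - measure_pmf.expectation (eigenvalue_distribution (perturbed_matrix (walk_matrix adj) A 0)) f)
    / complex_of_real (\<epsilon>\<^sup>2)"

definition spectral_noise ::
    "('v::finite \<Rightarrow> 'v \<Rightarrow> bool) \<Rightarrow> real^'v^'v \<Rightarrow> (complex \<Rightarrow> complex) \<Rightarrow> complex" where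
  "spectral_noise adj A f = Lim (at 0) (spectral_fluctuation adj A f)"

text \<open>On this type, \<open>*\<close> and \<open>^\<close> act entrywise, so powers are built from the matrix product.\<close>

primrec matrix_pow :: "real^'n^'n \<Rightarrow> nat \<Rightarrow> real^'n^'n" where
  "matrix_pow A 0 = mat 1"
| "matrix_pow A (Suc k) = A ** matrix_pow A k"

definition Y_coeff :: "('v::finite \<Rightarrow> 'v \<Rightarrow> bool) \<Rightarrow> real^'v^'v \<Rightarrow> nat \<Rightarrow> 'v \<Rightarrow> 'v \<Rightarrow> real" where
  "Y_coeff adj A j v w = (\<Sum>(j1, j2) \<in> {(j1, j2). j1 + j2 + 2 = j}.
      (A ** matrix_pow (walk_matrix adj) j1) $ v $ w *
      (A ** matrix_pow (walk_matrix adj) j2) $ w $ v)"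

definition alpha ::
    "('v::finite \<Rightarrow> 'v \<Rightarrow> bool) \<Rightarrow> 'w measure \<Rightarrow> ('w \<Rightarrow> real^'v^'v) \<Rightarrow> 'v \<Rightarrow> nat \<Rightarrow> nat \<Rightarrow> real" where
  "alpha adj P B b i j = (\<integral>\<omega>. (\<Sum>v \<in> UNIV - {b}. Y_coeff adj (B \<omega>) i b v * Y_coeff adj (B \<omega>) j b v) \<partial>P)"

definition H_term ::
    "('v::finite \<Rightarrow> 'v \<Rightarrow> bool) \<Rightarrow> 'w measure \<Rightarrow> ('w \<Rightarrow> real^'v^'v) \<Rightarrow> 'v \<Rightarrow>
      (complex \<Rightarrow> complex) \<Rightarrow> (complex \<Rightarrow> complex) \<Rightarrow> nat \<times> nat \<Rightarrow> complex" where
  "H_term adj P B b f g = (\<lambda>(i, j). of_nat i * of_nat j * complex_of_real (alpha adj P B b i j) *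
      fps_nth (fps_expansion f 0) i * fps_nth (fps_expansion g 0) j)"

definition H_form ::
    "('v::finite \<Rightarrow> 'v \<Rightarrow> bool) \<Rightarrow> 'w measure \<Rightarrow> ('w \<Rightarrow> real^'v^'v) \<Rightarrow> 'v \<Rightarrow>
      (complex \<Rightarrow> complex) \<Rightarrow> (complex \<Rightarrow> complex) \<Rightarrow> complex" where
  "H_form adj P B b f g = 1 / 2 * infsum (H_term adj P B b f g) UNIV"

end

(*
  The trace of (M + eps B)^k is a polynomial in eps whose coefficients of order 1 and 2 are
  k tr(B M^(k-1)) and (k/2) sum_{v,w} Y_k(v,w), with remainder O(eps^3) q^k for some q below the radius
  of convergence of f. Averaging a row of B over a stabilizer shows that the diagonal of B M^j vanishes
  almost surely; this kills the first-order term and the terms Y_k(v,v). Hence T_G(f) is a quadratic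
  form in B in which only products of entries from two different rows occur. Rows being independent and
  centred, the mean is 0, and the terms for ordered pairs (v,w) and (v',w') are uncorrelated unless
  {v,w} = {v',w'}. As Y_k(v,w) = Y_k(w,v), each unordered pair is counted four times, and homogeneity
  of the covariances makes the contribution of every base vertex equal.
*)

theory Submission
  imports Defs "Jordan_Normal_Form.Schur_Decomposition"
begin

text \<open>Single eigenvalues need not depend smoothly on eps and the matrices need not be
  diagonalizable, so only power sums, that is traces, are expanded. Size is measured by maximal
  absolute row sums: this norm is submultiplicative, at most 1 for the walk matrix, and bounds every
  eigenvalue. One bound for B therefore both keeps the spectrum inside the disk of convergence and
  controls the remainder.

  Expectations are never exchanged with an infinite sum. For each pair of rows the Taylor
  coefficients are collected in a deterministic kernel, and the noise agrees almost surely with a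
  quadratic polynomial in the entries. The double series in \<open>H_form\<close> is then a matter
  of bilinearity in these kernels.

  The factor 1/2 arises as follows. With n vertices, T_G carries 1 / (2 sqrt n) and a product of two
  carries 1 / (4 n). An ordered pair correlates with itself and with its reversal, which leaves 1 /
  (2 n) times a sum over base vertices: half of an average. Homogeneity is what replaces this
  average by the value at one chosen vertex.\<close>

no_notation Matrix.vec_index (infixl "$" 100) and fps_nth (infixl "$" 75)

section \<open>Power sums of eigenvalues\<close>

definition index_enum :: "nat \<Rightarrow> 'n::finite" where
  "index_enum = (SOME h. bij_betw h {0..<CARD('n)} UNIV)"

lemma bij_index_enum: "bij_betw (index_enum :: nat \<Rightarrow> 'n::finite) {0..<CARD('n)} UNIV"
  unfolding index_enum_def by (rule someI_ex[OF ex_bij_betw_nat_finite[OF finite]])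

text \<open>Rows and columns are relabelled by the same enumeration, so that products, diagonal sums
  and determinants are all preserved.\<close>

definition to_mat :: "'a^'n^'n \<Rightarrow> 'a mat" where
  "to_mat A = Matrix.mat CARD('n) CARD('n) (\<lambda>(i, j). A $ index_enum i $ index_enum j)"

lemma to_mat_carrier [simp]: "to_mat (A :: 'a^'n^'n) \<in> carrier_mat CARD('n) CARD('n)"
  and dim_to_mat [simp]: "dim_row (to_mat A) = CARD('n)" "dim_col (to_mat A) = CARD('n)"
  by (auto simp: to_mat_def)

lemma index_to_mat [simp]:
  "i < CARD('n) \<Longrightarrow> j < CARD('n) \<Longrightarrow>
    to_mat (A :: 'a^'n^'n) $$ (i, j) = A $ index_enum i $ index_enum j"
  by (simp add: to_mat_def)

lemma sum_index_enum: "(\<Sum>i\<in>{0..<CARD('n)}. F (index_enum i :: 'n::finite)) = (\<Sum>u\<in>UNIV. F u)"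
  by (rule sum.reindex_bij_betw[OF bij_index_enum])

text \<open>Conjugation with the enumeration is a sign-preserving bijection between permutations of
  the numbers below \<open>CARD('n)\<close> and permutations of the type; it matches the two Leibniz
  sums term by term.\<close>

lemma det_to_mat: "Determinant.det (to_mat A) = Determinants.det (A :: 'a::comm_ring_1^'n^'n)"
proof -
  let ?N = "{0..<CARD('n)}" and ?h = "index_enum :: nat \<Rightarrow> 'n"
  note bij = bij_index_enum[where 'n = 'n]
  have inj: "inj_on ?h ?N" and im: "?h ` ?N = UNIV"
    using bij by (auto simp: bij_betw_def)
  have perm: "map_permutation ?N ?h p permutes (UNIV :: 'n set)" if "p permutes ?N" for p
    using map_permutation_permutes[OF bij that] .
  have bij': "bij_betw (inv_into ?N ?h) UNIV ?N"
    by (rule bij_betw_inv_into[OF bij])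
  have "Determinant.det (to_mat A) =
    (\<Sum>p\<in>{p. p permutes ?N}. of_int (sign p) * (\<Prod>i\<in>?N. A $ ?h i $ ?h (p i)))"
    unfolding Determinant.det_def
  proof (simp only: dim_to_mat if_True simp_thms, intro sum.cong refl arg_cong2[of _ _ _ _ "(*)"] prod.cong)
    fix p i assume "p \<in> {p. p permutes ?N}" "i \<in> ?N"
    then show "to_mat A $$ (i, p i) = A $ ?h i $ ?h (p i)"
      using permutes_in_image[of p ?N i] by simp
  qed
  also have "\<dots> = (\<Sum>q\<in>{q. q permutes (UNIV :: 'n set)}.
      of_int (sign q) * (\<Prod>u\<in>UNIV. A $ u $ q u))"
  proof (rule sum.reindex_bij_witness[of _ "map_permutation UNIV (inv_into ?N ?h)" "map_permutation ?N ?h"])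
    fix p assume p: "p \<in> {p. p permutes ?N}"
    then have p': "p permutes ?N" by simp
    show "map_permutation UNIV (inv_into ?N ?h) (map_permutation ?N ?h p) = p"
      by (rule map_permutation_compose_inv[OF bij p']) (use inj in simp)
    show "map_permutation ?N ?h p \<in> {q. q permutes UNIV}" using perm[OF p'] by simp
    have "(\<Prod>u\<in>UNIV. A $ u $ map_permutation ?N ?h p u)
        = (\<Prod>i\<in>?N. A $ ?h i $ map_permutation ?N ?h p (?h i))"
      by (rule prod.reindex_bij_betw[OF bij, symmetric])
    also have "\<dots> = (\<Prod>i\<in>?N. A $ ?h i $ ?h (p i))"
      by (intro prod.cong refl) (simp add: map_permutation_apply[OF inj])
    finally show "of_int (sign (map_permutation ?N ?h p)) * (\<Prod>u\<in>UNIV. A $ u $ map_permutation ?N ?h p u)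
        = of_int (sign p) * (\<Prod>i\<in>?N. A $ ?h i $ ?h (p i))"
      by (simp add: sign_map_permutation[OF inj p'])
  next
    fix q assume "q \<in> {q. q permutes (UNIV :: 'n set)}"
    then have q: "q permutes (UNIV :: 'n set)" by simp
    show "map_permutation ?N ?h (map_permutation UNIV (inv_into ?N ?h) q) = q"
      by (rule map_permutation_compose_inv[OF bij' q]) (use bij in \<open>simp add: bij_betw_inv_into_right\<close>)
    show "map_permutation UNIV (inv_into ?N ?h) q \<in> {p. p permutes ?N}"
      using map_permutation_permutes[OF bij' q] by simp
  qed
  also have "\<dots> = Determinants.det A" by (simp add: Determinants.det_def)
  finally show ?thesis .
qed

lemma char_poly_to_mat: "char_poly (to_mat A) = char_polynomial (A :: 'a::comm_ring_1^'n^'n)"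
proof -
  have inj: "index_enum i = (index_enum j :: 'n) \<longleftrightarrow> i = j" if "i < CARD('n)" "j < CARD('n)" for i j
    using bij_index_enum[where 'n = 'n] that by (auto simp: bij_betw_def inj_on_def)
  have "char_poly_matrix (to_mat A)
      = to_mat (Finite_Cartesian_Product.mat [:0, 1:] - (\<chi> i j. [:A $ i $ j:]))"
    by (rule eq_matI) (auto simp: char_poly_matrix_def Finite_Cartesian_Product.mat_def inj)
  then show ?thesis
    by (simp add: char_poly_def char_polynomial_def det_to_mat)
qed

lemma to_mat_mult: "to_mat ((A :: 'a::comm_ring_1^'n^'n) ** C) = to_mat A * to_mat C"
  by (rule eq_matI)
    (auto simp: scalar_prod_def matrix_matrix_mult_def sum_index_enum[where 'n = 'n, symmetric])

definition complexify :: "real^'n^'n \<Rightarrow> complex^'n^'n" where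
  "complexify R = (\<chi> u v. complex_of_real (R $ u $ v))"

lemma matrix_pow_commute: "matrix_pow A k ** A = A ** matrix_pow A k"
  by (induction k) (simp_all add: matrix_mul_assoc[symmetric])

lemma to_mat_complexify_pow:
  "to_mat (complexify (matrix_pow R k)) = to_mat (complexify (R :: real^'n^'n)) ^\<^sub>m k"
proof (induction k)
  case 0
  have inj: "index_enum i = (index_enum j :: 'n) \<longleftrightarrow> i = j" if "i < CARD('n)" "j < CARD('n)" for i j
    using bij_index_enum[where 'n = 'n] that by (auto simp: bij_betw_def inj_on_def)
  show ?case
    by (rule eq_matI) (auto simp: complexify_def Finite_Cartesian_Product.mat_def inj)
next
  case (Suc k)
  \<comment> \<open>The two notions of power add the new factor on opposite sides; powers of
    \<open>R\<close> commute with \<open>R\<close>.\<close>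
  have "complexify (matrix_pow R (Suc k)) = complexify (matrix_pow R k) ** complexify R"
    unfolding matrix_pow.simps matrix_pow_commute[symmetric]
    by (simp add: complexify_def matrix_matrix_mult_def Finite_Cartesian_Product.vec_eq_iff)
  then show ?case by (simp add: to_mat_mult Suc)
qed

section \<open>Traces of powers through triangular form\<close>

lemma diag_sum_mult_commute:
  fixes X Y :: "'a::comm_ring_1 mat"
  assumes "X \<in> carrier_mat n n" "Y \<in> carrier_mat n n"
  shows "(\<Sum>i<n. (X * Y) $$ (i, i)) = (\<Sum>i<n. (Y * X) $$ (i, i))"
proof -
  have "(\<Sum>i<n. (X * Y) $$ (i, i)) = (\<Sum>i<n. \<Sum>j<n. X $$ (i, j) * Y $$ (j, i))"
    using assms by (auto simp: scalar_prod_def lessThan_atLeast0)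
  also have "\<dots> = (\<Sum>j<n. \<Sum>i<n. Y $$ (j, i) * X $$ (i, j))"
    by (subst sum.swap) (simp add: mult.commute)
  also have "\<dots> = (\<Sum>i<n. (Y * X) $$ (i, i))"
    using assms by (auto simp: scalar_prod_def lessThan_atLeast0)
  finally show ?thesis .
qed

text \<open>Both claims share one induction: a diagonal entry of the product collapses to a single
  term only because the power already vanishes below the diagonal.\<close>

lemma upper_triangular_pow:
  fixes T :: "'a::comm_ring_1 mat"
  assumes T: "T \<in> carrier_mat n n" and tri: "upper_triangular T"
  shows "(\<forall>i<n. \<forall>j<i. (T ^\<^sub>m k) $$ (i, j) = 0) \<and> (\<forall>i<n. (T ^\<^sub>m k) $$ (i, i) = (T $$ (i, i)) ^ k)"
proof (induction k)
  case 0
  then show ?case using T by auto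
next
  case (Suc k)
  have C: "T ^\<^sub>m k \<in> carrier_mat n n" using T by simp
  have mult: "(T ^\<^sub>m Suc k) $$ (i, j) = (\<Sum>l<n. (T ^\<^sub>m k) $$ (i, l) * T $$ (l, j))"
    if "i < n" "j < n" for i j
    using that T C by (auto simp: scalar_prod_def lessThan_atLeast0)
  have lower: "T $$ (i, j) = 0" if "j < i" "i < n" for i j
    using tri that T by (auto simp: upper_triangular_def)
  show ?case
  proof (intro conjI allI impI)
    fix i j assume ij: "i < n" "j < i"
    have "(T ^\<^sub>m k) $$ (i, l) * T $$ (l, j) = 0" if "l < n" for l
      using Suc ij that lower by (cases "l < i") auto
    then show "(T ^\<^sub>m Suc k) $$ (i, j) = 0" using mult[of i j] ij by simp
  next
    fix i assume i: "i < n"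
    have "(T ^\<^sub>m k) $$ (i, l) * T $$ (l, i) = (if l = i then (T $$ (i, i)) ^ Suc k else 0)"
      if "l < n" for l
      using Suc i that lower[of i l] by (cases "l < i") (auto simp: mult.commute)
    then show "(T ^\<^sub>m Suc k) $$ (i, i) = (T $$ (i, i)) ^ Suc k"
      using mult[of i i] i by simp
  qed
qed

lemma proots_linear_factors: "proots (\<Prod>a\<leftarrow>as. [:- a, 1:]) = mset (as :: 'a::idom list)"
proof (induction as)
  case (Cons a as)
  have "(\<Prod>a\<leftarrow>as. [:- a, 1:]) \<noteq> 0" by (auto simp: prod_list_zero_iff)
  then show ?case using Cons by (simp add: proots_mult del: mult_pCons_left)
qed simp

text \<open>A complex matrix is similar to a triangular one whose diagonal lists the roots of the
  characteristic polynomial with multiplicity. Powers act entrywise on that diagonal, and cyclicity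
  of the trace removes the conjugating matrices.\<close>

lemma power_sum_eigenvalues:
  fixes R :: "real^'n^'n"
  shows "(\<Sum>x\<in>#proots (char_polynomial (complexify R)). x ^ k) = of_real (trace (matrix_pow R k))"
proof -
  let ?A = "to_mat (complexify R)" and ?n = "CARD('n)"
  have A: "?A \<in> carrier_mat ?n ?n" by simp
  obtain as where as: "char_poly ?A = (\<Prod>a\<leftarrow>as. [:- a, 1:])"
    using char_poly_factorized[OF A] by blast
  obtain T X Y where "schur_decomposition ?A as = (T, X, Y)" by (cases "schur_decomposition ?A as") auto
  from schur_decomposition[OF A as this]
  have wit: "similar_mat_wit ?A T X Y" and tri: "upper_triangular T" and diag: "diag_mat T = as"
    by auto
  have T: "T \<in> carrier_mat ?n ?n" and X: "X \<in> carrier_mat ?n ?n" and Y: "Y \<in> carrier_mat ?n ?n"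
    and YX: "Y * X = 1\<^sub>m ?n"
    using wit by (auto simp: similar_mat_wit_def Let_def)
  have Tk: "T ^\<^sub>m k \<in> carrier_mat ?n ?n" using T by simp
  have "of_real (trace (matrix_pow R k)) = (\<Sum>u\<in>UNIV. complexify (matrix_pow R k) $ u $ u)"
    by (simp add: trace_def complexify_def)
  also have "\<dots> = (\<Sum>i<?n. to_mat (complexify (matrix_pow R k)) $$ (i, i))"
    by (simp add: sum_index_enum[symmetric] lessThan_atLeast0)
  also have "\<dots> = (\<Sum>i<?n. (X * (T ^\<^sub>m k * Y)) $$ (i, i))"
    using similar_mat_wit_pow_id[OF wit, of k] X Y Tk by (simp add: to_mat_complexify_pow assoc_mult_mat[OF X Tk Y])
  also have "\<dots> = (\<Sum>i<?n. ((T ^\<^sub>m k * Y) * X) $$ (i, i))"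
    by (rule diag_sum_mult_commute) (use X Y Tk in auto)
  also have "(T ^\<^sub>m k * Y) * X = T ^\<^sub>m k"
    using Tk by (simp add: assoc_mult_mat[OF Tk Y X] YX right_mult_one_mat[OF Tk])
  also have "(\<Sum>i<?n. (T ^\<^sub>m k) $$ (i, i)) = (\<Sum>i<?n. (T $$ (i, i)) ^ k)"
    using upper_triangular_pow[OF T tri, of k] by simp
  also have "\<dots> = (\<Sum>x\<leftarrow>as. x ^ k)"
    using T by (simp add: diag[symmetric] diag_mat_def o_def interv_sum_list_conv_sum_set_nat lessThan_atLeast0)
  also have "\<dots> = (\<Sum>x\<in>#mset as. x ^ k)" by (simp flip: sum_mset_sum_list)
  also have "mset as = proots (char_polynomial (complexify R))"
    by (simp add: char_poly_to_mat[symmetric] as proots_linear_factors)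
  finally show ?thesis by simp
qed

text \<open>Read the eigenvector equation at a coordinate \<open>m\<close> where the eigenvector has
  maximal modulus, and divide by that modulus.\<close>

lemma eigenvalue_le_row_sum:
  fixes A :: "complex^'n^'n"
  assumes x: "x \<in># proots (char_polynomial A)"
    and rows: "\<And>u. (\<Sum>v\<in>UNIV. norm (A $ u $ v)) \<le> r"
  shows "norm x \<le> r"
proof -
  let ?n = "CARD('n)"
  have A: "to_mat A \<in> carrier_mat ?n ?n" by simp
  have "poly (char_poly (to_mat A)) x = 0"
    using x by (cases "char_polynomial A = 0") (auto simp: char_poly_to_mat)
  then have "eigenvalue (to_mat A) x" using eigenvalue_root_char_poly[OF A] by simp
  then obtain w where w: "w \<in> carrier_vec ?n" "w \<noteq> 0\<^sub>v ?n" "to_mat A *\<^sub>v w = x \<cdot>\<^sub>v w"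
    by (auto simp: eigenvalue_def eigenvector_def)
  define F where "F i = norm (vec_index w i)" for i
  obtain m where m: "m < ?n" "\<And>i. i < ?n \<Longrightarrow> F i \<le> F m"
  proof -
    have "Max (F ` {..<?n}) \<in> F ` {..<?n}" by (intro Max_in) (auto simp: lessThan_empty_iff)
    then obtain m where "m < ?n" "Max (F ` {..<?n}) = F m" by auto
    with that[of m] show ?thesis by (metis Max_ge finite_imageI finite_lessThan imageI lessThan_iff)
  qed
  have pos: "F m > 0"
  proof (rule ccontr)
    assume "\<not> F m > 0"
    then have "F i = 0" if "i < ?n" for i using m(2)[OF that] by (simp add: F_def)
    then have "w = 0\<^sub>v ?n" using w(1) by (intro eq_vecI) (auto simp: F_def)
    with w(2) show False by simp
  qed
  have "norm x * F m = norm (vec_index (to_mat A *\<^sub>v w) m)"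
    using w m by (simp add: F_def norm_mult)
  also have "\<dots> = norm (\<Sum>j\<in>{0..<?n}. to_mat A $$ (m, j) * vec_index w j)"
    using w(1) m(1) by (simp add: scalar_prod_def)
  also have "\<dots> \<le> (\<Sum>j\<in>{0..<?n}. norm (to_mat A $$ (m, j)) * F m)"
    by (intro order_trans[OF norm_sum] sum_mono) (auto simp: norm_mult F_def[symmetric] intro!: mult_left_mono m(2))
  also have "\<dots> = (\<Sum>v\<in>UNIV. norm (A $ index_enum m $ v)) * F m"
    using m(1) by (simp add: sum_distrib_right[symmetric] sum_index_enum[symmetric])
  also have "\<dots> \<le> r * F m" by (intro mult_right_mono rows) (use pos in simp)
  finally show ?thesis using pos by simp
qed

lemma size_eigenvalues: "size (proots (char_polynomial (A :: complex^'n^'n))) = CARD('n)"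
proof -
  obtain as where as: "char_poly (to_mat A) = (\<Prod>a\<leftarrow>as. [:- a, 1:])" "length as = CARD('n)"
    using char_poly_factorized[of "to_mat A" "CARD('n)"] by auto
  then show ?thesis by (simp add: char_poly_to_mat[symmetric] proots_linear_factors)
qed

lemma sum_mset_eq_sum_count:
  assumes "finite S" "set_mset X \<subseteq> S"
  shows "(\<Sum>x\<in>S. of_nat (count X x) * F x) = (\<Sum>x\<in>#X. F x :: 'a::comm_semiring_1)"
  using assms(2)
proof (induction X)
  case (add a X)
  have "(\<Sum>x\<in>S. of_nat (count (add_mset a X) x) * F x)
      = (\<Sum>x\<in>S. (if x = a then F a else 0) + of_nat (count X x) * F x)"
    by (intro sum.cong) (auto simp: algebra_simps)
  also have "\<dots> = F a + (\<Sum>x\<in>S. of_nat (count X x) * F x)"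
    using assms(1) add.prems by (simp add: sum.distrib)
  finally show ?case using add by simp
qed simp

lemma expectation_eigenvalue_distribution:
  fixes A :: "complex^'n^'n" and f :: "complex \<Rightarrow> complex"
  shows "measure_pmf.expectation (eigenvalue_distribution A) f
    = (\<Sum>x\<in>#proots (char_polynomial A). f x) / of_nat CARD('n)"
proof -
  let ?X = "proots (char_polynomial A)"
  \<comment> \<open>\<open>pmf_of_multiset\<close> has the intended point masses only for a nonempty
    multiset.\<close>
  have ne: "?X \<noteq> {#}" using size_eigenvalues[of A] by auto
  have "measure_pmf.expectation (eigenvalue_distribution A) f
      = (\<Sum>x\<in>set_mset ?X. pmf (eigenvalue_distribution A) x *\<^sub>R f x)"
    by (rule integral_measure_pmf) (use ne in \<open>auto simp: eigenvalue_distribution_def\<close>)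
  also have "\<dots> = (\<Sum>x\<in>set_mset ?X. of_nat (count ?X x) * f x) / of_nat CARD('n)"
    by (simp add: eigenvalue_distribution_def pmf_of_multiset[OF ne] size_eigenvalues
        scaleR_conv_of_real sum_divide_distrib)
  finally show ?thesis by (simp add: sum_mset_eq_sum_count)
qed

section \<open>Perturbation expansion of matrix powers\<close>

text \<open>The coefficient of \<open>\<epsilon> ^ j\<close> in the \<open>k\<close>-th power of
  \<open>M + \<epsilon> *\<^sub>R A\<close>: the sum of all words of length \<open>k\<close> in the
  letters \<open>M\<close> and \<open>A\<close> with exactly \<open>j\<close> letters
  \<open>A\<close>. The recursion splits off the leftmost letter.\<close>

primrec pert_coeff :: "real^'n^'n \<Rightarrow> real^'n^'n \<Rightarrow> nat \<Rightarrow> nat \<Rightarrow> real^'n^'n" where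
  "pert_coeff M A 0 j = (if j = 0 then Finite_Cartesian_Product.mat 1 else 0)"
| "pert_coeff M A (Suc k) j = M ** pert_coeff M A k j + (if j = 0 then 0 else A ** pert_coeff M A k (j - 1))"

lemma pert_coeff_0 [simp]: "pert_coeff M A k 0 = matrix_pow M k"
  by (induction k) simp_all

lemma pert_coeff_beyond: "k < j \<Longrightarrow> pert_coeff M A k j = 0"
  by (induction k arbitrary: j) simp_all

lemma matrix_mult_sum_right: "(X :: real^'n^'n) ** (\<Sum>i\<in>I. F i) = (\<Sum>i\<in>I. X ** F i)"
  by (induction I rule: infinite_finite_induct) (simp_all add: matrix_add_ldistrib)

lemma matrix_mult_scaleR_right: "(X :: real^'n^'n) ** (c *\<^sub>R Y) = c *\<^sub>R (X ** Y)"
  by (simp add: scalar_matrix_assoc matrix_scalar_ac flip: scalar_mult_eq_scaleR)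

lemma matrix_mult_scaleR_left: "(c *\<^sub>R X) ** (Y :: real^'n^'n) = c *\<^sub>R (X ** Y)"
  by (simp add: matrix_matrix_mult_def Finite_Cartesian_Product.vec_eq_iff sum_distrib_left mult.assoc)

lemma matrix_pow_perturbed:
  "matrix_pow (M + \<epsilon> *\<^sub>R A) k = (\<Sum>j\<le>k. \<epsilon> ^ j *\<^sub>R pert_coeff M A k j)"
proof (induction k)
  case (Suc k)
  let ?W = "pert_coeff M A"
  have "(\<Sum>j\<le>Suc k. \<epsilon> ^ j *\<^sub>R ?W (Suc k) j)
      = (\<Sum>j\<le>Suc k. \<epsilon> ^ j *\<^sub>R (M ** ?W k j)) +
        (\<Sum>j\<le>Suc k. \<epsilon> ^ j *\<^sub>R (if j = 0 then 0 else A ** ?W k (j - 1)))"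
    by (simp only: pert_coeff.simps scaleR_add_right sum.distrib)
  also have "(\<Sum>j\<le>Suc k. \<epsilon> ^ j *\<^sub>R (M ** ?W k j)) = (\<Sum>j\<le>k. \<epsilon> ^ j *\<^sub>R (M ** ?W k j))"
    by (simp add: pert_coeff_beyond)
  also have "\<dots> = M ** matrix_pow (M + \<epsilon> *\<^sub>R A) k"
    by (simp add: Suc matrix_mult_sum_right matrix_mult_scaleR_right)
  also have "(\<Sum>j\<le>Suc k. \<epsilon> ^ j *\<^sub>R (if j = 0 then 0 else A ** ?W k (j - 1)))
      = (\<Sum>j\<le>k. \<epsilon> *\<^sub>R (\<epsilon> ^ j *\<^sub>R (A ** ?W k j)))"
    by (subst sum.atMost_Suc_shift) simp
  also have "\<dots> = (\<epsilon> *\<^sub>R A) ** matrix_pow (M + \<epsilon> *\<^sub>R A) k"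
    by (simp add: Suc matrix_mult_sum_right matrix_mult_scaleR_right scaleR_sum_right matrix_mult_scaleR_left mult.commute)
  finally show ?case by (simp add: matrix_matrix_mult_def Finite_Cartesian_Product.vec_eq_iff sum.distrib algebra_simps)
qed simp

section \<open>Maximal absolute row sums: the operator norm belonging to the sup norm\<close>

definition row_sum_le :: "real^'n^'n \<Rightarrow> real \<Rightarrow> bool" where
  "row_sum_le X r \<longleftrightarrow> (\<forall>u. (\<Sum>v\<in>UNIV. \<bar>X $ u $ v\<bar>) \<le> r)"

lemma row_sum_le_nonneg: "row_sum_le X r \<Longrightarrow> 0 \<le> r"
  unfolding row_sum_le_def by (meson order_trans sum_nonneg abs_ge_zero)

lemma row_sum_le_entry: "row_sum_le X r \<Longrightarrow> \<bar>X $ u $ v\<bar> \<le> r"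
  unfolding row_sum_le_def by (meson order_trans member_le_sum abs_ge_zero UNIV_I finite)

lemma row_sum_le_add: "row_sum_le X r \<Longrightarrow> row_sum_le Y s \<Longrightarrow> row_sum_le (X + Y) (r + s)"
  unfolding row_sum_le_def
  by (auto intro!: order_trans[OF sum_mono[OF abs_triangle_ineq]] add_mono simp: sum.distrib)

lemma row_sum_le_scaleR: "row_sum_le X r \<Longrightarrow> row_sum_le (c *\<^sub>R X) (\<bar>c\<bar> * r)"
  unfolding row_sum_le_def by (auto simp: abs_mult sum_distrib_left[symmetric] intro!: mult_left_mono)

lemma row_sum_le_mult:
  assumes X: "row_sum_le X r" and Y: "row_sum_le Y s"
  shows "row_sum_le (X ** Y) (r * s)"
  unfolding row_sum_le_def
proof
  fix u
  have "(\<Sum>v\<in>UNIV. \<bar>(X ** Y) $ u $ v\<bar>) \<le> (\<Sum>v\<in>UNIV. \<Sum>w\<in>UNIV. \<bar>X $ u $ w\<bar> * \<bar>Y $ w $ v\<bar>)"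
    by (intro sum_mono) (simp add: matrix_matrix_mult_def sum_abs flip: abs_mult)
  also have "\<dots> = (\<Sum>w\<in>UNIV. \<bar>X $ u $ w\<bar> * (\<Sum>v\<in>UNIV. \<bar>Y $ w $ v\<bar>))"
    by (subst sum.swap) (simp add: sum_distrib_left)
  also have "\<dots> \<le> (\<Sum>w\<in>UNIV. \<bar>X $ u $ w\<bar> * s)"
    using Y by (intro sum_mono mult_left_mono) (auto simp: row_sum_le_def)
  also have "\<dots> \<le> r * s"
    using X row_sum_le_nonneg[OF Y] by (auto simp: sum_distrib_right[symmetric] row_sum_le_def intro!: mult_right_mono)
  finally show "(\<Sum>v\<in>UNIV. \<bar>(X ** Y) $ u $ v\<bar>) \<le> r * s" .
qed

lemma row_sum_le_one: "row_sum_le (Finite_Cartesian_Product.mat 1) 1"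
  by (simp add: row_sum_le_def Finite_Cartesian_Product.mat_def if_distrib[of abs] cong: if_cong)

lemma row_sum_le_matrix_pow:
  assumes "row_sum_le X 1" shows "row_sum_le (matrix_pow X k) 1"
  by (induction k) (use row_sum_le_one row_sum_le_mult[OF assms] in fastforce)+

lemma abs_trace_le: "row_sum_le (X :: real^'n^'n) r \<Longrightarrow> \<bar>trace X\<bar> \<le> real CARD('n) * r"
  unfolding trace_def
  by (rule order_trans[OF sum_abs], rule order_trans[OF sum_mono[where g = "\<lambda>_. r"]])
    (auto intro: row_sum_le_entry)

text \<open>There are \<open>k choose j\<close> words, each of norm at most \<open>c ^ j\<close>;
  the recursion for the words becomes Pascal's rule.\<close>

lemma row_sum_le_pert_coeff:
  assumes M: "row_sum_le M 1" and A: "row_sum_le A c"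
  shows "row_sum_le (pert_coeff M A k j) (real (k choose j) * c ^ j)"
proof (induction k arbitrary: j)
  case 0
  then show ?case using row_sum_le_one row_sum_le_nonneg[OF A] by (auto simp: row_sum_le_def)
next
  case (Suc k)
  show ?case
  proof (cases j)
    case 0
    then show ?thesis using row_sum_le_mult[OF M Suc[of 0]] by simp
  next
    case (Suc i)
    have "row_sum_le (M ** pert_coeff M A k (Suc i) + A ** pert_coeff M A k i)
        (1 * (real (k choose Suc i) * c ^ Suc i) + c * (real (k choose i) * c ^ i))"
      by (intro row_sum_le_add row_sum_le_mult M A Suc.IH)
    then show ?thesis by (simp add: Suc algebra_simps)
  qed
qed

section \<open>The coefficients of order one and two and their traces\<close>

lemma pert_coeff_1:
  "pert_coeff M A k 1 = (\<Sum>i<k. matrix_pow M i ** (A ** matrix_pow M (k - 1 - i)))"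
proof (induction k)
  case (Suc k)
  have "pert_coeff M A (Suc k) 1
      = A ** matrix_pow M k + (\<Sum>i<k. M ** (matrix_pow M i ** (A ** matrix_pow M (k - 1 - i))))"
    using Suc by (simp add: matrix_mult_sum_right)
  also have "\<dots> = (\<Sum>i<Suc k. matrix_pow M i ** (A ** matrix_pow M (Suc k - 1 - i)))"
    by (subst sum.lessThan_Suc_shift) (simp add: matrix_mul_assoc)
  finally show ?case .
qed simp

text \<open>Here \<open>i\<close> is the position of the leftmost \<open>A\<close>; the remaining
  word of length \<open>k - 1 - i\<close> contains one further \<open>A\<close>.\<close>

lemma pert_coeff_2:
  "pert_coeff M A k 2 = (\<Sum>i<k. matrix_pow M i ** (A ** pert_coeff M A (k - 1 - i) 1))"
proof (induction k)
  case (Suc k)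
  have "pert_coeff M A (Suc k) 2
      = A ** pert_coeff M A k 1 + (\<Sum>i<k. M ** (matrix_pow M i ** (A ** pert_coeff M A (k - 1 - i) 1)))"
    using Suc by (simp add: matrix_mult_sum_right numeral_2_eq_2)
  also have "\<dots> = (\<Sum>i<Suc k. matrix_pow M i ** (A ** pert_coeff M A (Suc k - 1 - i) 1))"
    by (subst sum.lessThan_Suc_shift) (simp add: matrix_mul_assoc)
  finally show ?case .
qed simp

lemma matrix_pow_add: "matrix_pow M i ** matrix_pow M j = matrix_pow M (i + j)"
  by (induction i) (simp_all add: matrix_mul_assoc[symmetric])

lemma trace_sum: "trace (\<Sum>i\<in>I. F i :: real^'n^'n) = (\<Sum>i\<in>I. trace (F i))"
  by (induction I rule: infinite_finite_induct) (simp_all add: trace_add, simp_all add: trace_def)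

lemma trace_pert_coeff_1:
  "trace (pert_coeff M A k 1) = real k * trace (A ** matrix_pow M (k - 1))"
proof -
  have "trace (matrix_pow M i ** (A ** matrix_pow M (k - 1 - i))) = trace (A ** matrix_pow M (k - 1))"
    if "i < k" for i
    using that by (subst trace_mul_sym) (simp add: matrix_pow_add flip: matrix_mul_assoc)
  then show ?thesis by (simp add: pert_coeff_1 trace_sum del: One_nat_def)
qed

text \<open>By cyclicity the trace of a word with two letters \<open>A\<close> depends only on the
  gap \<open>l\<close> between them. Gap \<open>l\<close> occurs \<open>k - 1 - l\<close> times, and
  gaps \<open>l\<close> and \<open>k - 2 - l\<close> give the same trace because the two letters can
  be interchanged cyclically. Averaging the two counts \<open>k - 1 - l\<close> and
  \<open>l + 1\<close> yields the uniform weight \<open>k / 2\<close>.\<close>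

lemma trace_pert_coeff_2:
  "trace (pert_coeff M A k 2)
    = real k / 2 * (\<Sum>l<k - 1. trace (A ** matrix_pow M l ** (A ** matrix_pow M (k - 2 - l))))"
proof -
  define \<tau> where "\<tau> l = trace (A ** matrix_pow M l ** (A ** matrix_pow M (k - 2 - l)))" for l
  have "trace (pert_coeff M A k 2) = (\<Sum>i<k. \<Sum>l<k - 1 - i. \<tau> l)"
  proof (unfold pert_coeff_2 pert_coeff_1 trace_sum matrix_mult_sum_right, intro sum.cong refl)
    fix i l assume "i \<in> {..<k}" "l \<in> {..<k - 1 - i}"
    then have *: "k - 1 - i - 1 - l + i = k - 2 - l" by simp
    have "trace (matrix_pow M i ** (A ** (matrix_pow M l ** (A ** matrix_pow M (k - 1 - i - 1 - l)))))
       = trace (A ** matrix_pow M l ** (A ** (matrix_pow M (k - 1 - i - 1 - l) ** matrix_pow M i)))"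
      by (subst trace_mul_sym) (simp only: matrix_mul_assoc)
    then show "trace (matrix_pow M i ** (A ** (matrix_pow M l ** (A ** matrix_pow M (k - 1 - i - 1 - l))))) = \<tau> l"
      by (simp only: \<tau>_def matrix_pow_add *)
  qed
  also have "\<dots> = (\<Sum>i<k. \<Sum>l<k - 1. if l < k - 1 - i then \<tau> l else 0)"
    by (intro sum.cong refl sum.mono_neutral_cong_left) auto
  also have "\<dots> = (\<Sum>l<k - 1. \<Sum>i<k. if l < k - 1 - i then \<tau> l else 0)"
    by (rule sum.swap)
  also have "\<dots> = (\<Sum>l<k - 1. real (k - 1 - l) * \<tau> l)"
  proof (intro sum.cong refl)
    fix l
    have "{i \<in> {..<k}. l < k - 1 - i} = {..<k - 1 - l}" by auto
    then show "(\<Sum>i<k. if l < k - 1 - i then \<tau> l else 0) = real (k - 1 - l) * \<tau> l"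
      by (simp flip: sum.inter_filter)
  qed
  finally have t1: "trace (pert_coeff M A k 2) = (\<Sum>l<k - 1. real (k - 1 - l) * \<tau> l)" .
  \<comment> \<open>Reverse the order of summation and use the symmetry of \<open>\<tau>\<close>
    under \<open>l\<close> to \<open>k - 2 - l\<close>.\<close>
  also have "\<dots> = (\<Sum>l<k - 1. real (Suc l) * \<tau> l)"
  proof (subst sum.nat_diff_reindex[symmetric], intro sum.cong refl)
    fix l assume l: "l \<in> {..<k - 1}"
    then have e: "k - 2 - (k - 1 - Suc l) = l" "k - 1 - Suc l = k - 2 - l" "k - 1 - (k - 1 - Suc l) = Suc l" by auto
    have "\<tau> (k - 1 - Suc l) = \<tau> l"
      unfolding \<tau>_def e(1) by (subst trace_mul_sym) (simp only: e(2))
    then show "real (k - 1 - (k - 1 - Suc l)) * \<tau> (k - 1 - Suc l) = real (Suc l) * \<tau> l"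
      by (simp only: e(3))
  qed
  finally have t2: "trace (pert_coeff M A k 2) = (\<Sum>l<k - 1. real (Suc l) * \<tau> l)" .
  have "2 * trace (pert_coeff M A k 2) = (\<Sum>l<k - 1. real (k - 1 - l) * \<tau> l + real (Suc l) * \<tau> l)"
    using t1 t2 by (simp add: sum.distrib)
  also have "\<dots> = (\<Sum>l<k - 1. real k * \<tau> l)"
    by (intro sum.cong refl) (auto simp: of_nat_diff algebra_simps)
  finally show ?thesis by (simp add: sum_distrib_left[symmetric] \<tau>_def)
qed

section \<open>Second-order asymptotics of the empirical spectral distribution\<close>

abbreviation taylor :: "(complex \<Rightarrow> complex) \<Rightarrow> nat \<Rightarrow> complex" where
  "taylor f \<equiv> fps_nth (fps_expansion f 0)"

text \<open>By compactness a uniform \<open>e\<close>-neighbourhood of the closed disk lies in the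
  domain. It contains the ball of radius \<open>1 + e\<close>, since a point \<open>z\<close>
  outside the closed disk has distance \<open>norm z - 1\<close> from its radial projection
  \<open>sgn z\<close>.\<close>

lemma analytic_on_cball_taylor:
  assumes "f analytic_on cball 0 1"
  obtains R where "R > 1" "\<And>z. norm z < R \<Longrightarrow> (\<lambda>k. taylor f k * z ^ k) sums f z"
proof -
  obtain S where S: "open S" "cball 0 1 \<subseteq> S" "f holomorphic_on S"
    using assms by (auto simp: analytic_on_holomorphic)
  obtain e where e: "e > 0" "(\<Union>x\<in>cball 0 1. ball x e) \<subseteq> S"
    using compact_subset_open_imp_ball_epsilon_subset[of "cball 0 1" S] S by auto
  have "ball 0 (1 + e) \<subseteq> S"
  proof
    fix z :: complex assume z: "z \<in> ball 0 (1 + e)"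
    show "z \<in> S"
    proof (cases "norm z \<le> 1")
      case True
      then show ?thesis using S by auto
    next
      case False
      have polar: "of_real (norm z) * sgn z = z" using False by (auto simp: sgn_eq)
      have "norm (sgn z - of_real (norm z) * sgn z) = norm (of_real (1 - norm z) * sgn z)"
        by (simp only: left_diff_distrib of_real_diff of_real_1 mult_1)
      also have "\<dots> = \<bar>1 - norm z\<bar> * norm (sgn z)" by (simp only: norm_mult norm_of_real)
      also have "\<dots> = norm z - 1" using False by (auto simp: norm_sgn)
      finally have "z \<in> ball (sgn z) e" unfolding polar using z by (simp add: dist_norm)
      moreover have "sgn z \<in> cball 0 1" by (simp add: norm_sgn)
      ultimately show ?thesis using e(2) by blast
    qed
  qed
  then have hol: "f holomorphic_on ball 0 (1 + e)" using S holomorphic_on_subset by blast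
  show thesis
  proof (rule that[of "1 + e"])
    fix z :: complex assume "norm z < 1 + e"
    then show "(\<lambda>k. taylor f k * z ^ k) sums f z"
      using holomorphic_power_series[OF hol, of z] by (simp add: fps_expansion_def)
  qed (use e in simp)
qed

text \<open>Convergence at a point of larger modulus, here the midpoint of \<open>r\<close> and
  \<open>R\<close>, forces absolute convergence at \<open>r\<close>.\<close>

lemma summable_taylor_powers:
  assumes "\<And>z. norm z < R \<Longrightarrow> (\<lambda>k. taylor f k * z ^ k) sums f z" "0 \<le> r" "r < R"
  shows "summable (\<lambda>k. norm (taylor f k) * r ^ k)"
proof -
  have "summable (\<lambda>k. taylor f k * of_real ((r + R) / 2) ^ k)"
    using assms by (intro sums_summable[OF assms(1)]) (simp only: norm_of_real, simp)
  then have "summable (\<lambda>k. norm (taylor f k * of_real r ^ k))"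
    by (rule powser_insidea) (use assms in \<open>simp only: norm_of_real, simp\<close>)
  then show ?thesis using assms by (simp add: norm_mult norm_power)
qed

text \<open>The quadratic weight dominates every growth in \<open>k\<close> that occurs later: the
  binomials \<open>k choose 1\<close> and \<open>k choose 2\<close>, and the product of
  \<open>k\<close> with a walk kernel of size at most \<open>k\<close>.\<close>

lemma summable_taylor_squares:
  assumes "f analytic_on cball 0 1"
  shows "summable (\<lambda>k. (real k)\<^sup>2 * norm (taylor f k))"
proof -
  obtain R where R: "R > 1" "\<And>z. norm z < R \<Longrightarrow> (\<lambda>k. taylor f k * z ^ k) sums f z"
    using analytic_on_cball_taylor[OF assms] by blast
  \<comment> \<open>As \<open>d \<le> 1\<close>, one gets
    \<open>(1 + d)\<^sup>2 \<le> 1 + 3 * d < 1 + 4 * d \<le> R\<close>; Bernoulli's inequality then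
    bounds \<open>k * d\<close> by \<open>(1 + d) ^ k\<close>.\<close>
  define d where "d = min 1 ((R - 1) / 4)"
  have d: "d > 0" "(1 + d)\<^sup>2 < R"
  proof -
    show "d > 0" using R by (simp add: d_def)
    then have dd: "d * d \<le> d * 1" by (intro mult_left_mono) (auto simp: d_def)
    moreover have "4 * d \<le> R - 1" by (simp add: d_def min_def field_simps)
    moreover have "(1 + d)\<^sup>2 = 1 + 2 * d + d * d" by (simp add: power2_eq_square algebra_simps)
    ultimately show "(1 + d)\<^sup>2 < R" using \<open>d > 0\<close> dd by linarith
  qed
  have bound: "(real k)\<^sup>2 \<le> ((1 + d)\<^sup>2) ^ k / d\<^sup>2" for k
  proof -
    have "real k * d \<le> (1 + d) ^ k" using Bernoulli_inequality[of d k] d by simp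
    then have "(real k * d)\<^sup>2 \<le> ((1 + d) ^ k)\<^sup>2" using d by (intro power_mono) auto
    then show ?thesis using d by (simp add: field_simps flip: power_mult)
  qed
  have "summable (\<lambda>k. norm (taylor f k) * ((1 + d)\<^sup>2) ^ k / d\<^sup>2)"
    by (intro summable_divide summable_taylor_powers[OF R(2)]) (use d in auto)
  then show ?thesis
  proof (rule summable_comparison_test'[where N = 0])
    fix k
    show "norm ((real k)\<^sup>2 * norm (taylor f k)) \<le> norm (taylor f k) * ((1 + d)\<^sup>2) ^ k / d\<^sup>2"
      using mult_left_mono[OF bound[of k], of "norm (taylor f k)"] by (simp add: mult.commute)
  qed
qed

section \<open>Expansion of spectral averages with a cubic remainder\<close>

lemma sums_sum_mset:
  fixes G :: "'b \<Rightarrow> 'a::real_normed_vector"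
  shows "(\<And>x. x \<in># X \<Longrightarrow> (\<lambda>k. F k x) sums G x) \<Longrightarrow> (\<lambda>k. \<Sum>x\<in>#X. F k x) sums (\<Sum>x\<in>#X. G x)"
  by (induction X) (auto intro: sums_add)

text \<open>The row sum bound \<open>r\<close> confines all eigenvalues to the disk where the series
  represents \<open>f\<close>, so it can be summed over the eigenvalues term by term; the power sums
  are traces.\<close>

lemma expectation_power_series:
  fixes R :: "real^'n^'n"
  assumes "row_sum_le R r" "\<And>z. norm z \<le> r \<Longrightarrow> (\<lambda>k. a k * z ^ k) sums f z"
  shows "(\<lambda>k. a k * of_real (trace (matrix_pow R k)))
    sums (of_nat CARD('n) * measure_pmf.expectation (eigenvalue_distribution (complexify R)) f)"
proof -
  let ?X = "proots (char_polynomial (complexify R))"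
  have "(\<lambda>k. \<Sum>x\<in>#?X. a k * x ^ k) sums (\<Sum>x\<in>#?X. f x)"
    by (intro sums_sum_mset assms(2), erule eigenvalue_le_row_sum)
      (use assms(1) in \<open>simp add: complexify_def row_sum_le_def\<close>)
  moreover have "(\<Sum>x\<in>#?X. a k * x ^ k) = a k * of_real (trace (matrix_pow R k))" for k
    unfolding power_sum_eigenvalues[symmetric] by (simp add: sum_mset_distrib_left multiset.map_comp o_def)
  moreover have "of_nat CARD('n) * measure_pmf.expectation (eigenvalue_distribution (complexify R)) f = (\<Sum>x\<in>#?X. f x)"
    unfolding expectation_eigenvalue_distribution times_divide_eq_right by (rule nonzero_mult_div_cancel_left) simp
  ultimately show ?thesis by simp
qed

lemma perturbed_matrix_eq: "perturbed_matrix M A \<epsilon> = complexify (M + \<epsilon> *\<^sub>R A)"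
  by (simp add: perturbed_matrix_def complexify_def Finite_Cartesian_Product.vec_eq_iff)

text \<open>In each term of order \<open>j \<ge> 3\<close> all but three factors
  \<open>\<bar>\<epsilon>\<bar>\<close> are replaced by \<open>\<delta>\<close>. What remains is
  part of the binomial expansion of \<open>(1 + c * \<delta>) ^ k\<close>, with a prefactor
  independent of \<open>k\<close>.\<close>

lemma trace_pow_expansion_error:
  fixes M A :: "real^'n^'n"
  assumes M: "row_sum_le M 1" and A: "row_sum_le A c" and \<delta>: "\<bar>\<epsilon>\<bar> \<le> \<delta>" "0 < \<delta>"
  shows "\<bar>trace (matrix_pow (M + \<epsilon> *\<^sub>R A) k) - trace (matrix_pow M k)
      - \<epsilon> * trace (pert_coeff M A k 1) - \<epsilon>\<^sup>2 * trace (pert_coeff M A k 2)\<bar>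
    \<le> real CARD('n) / \<delta> ^ 3 * \<bar>\<epsilon>\<bar> ^ 3 * (1 + c * \<delta>) ^ k"
proof -
  let ?t = "\<lambda>j. trace (pert_coeff M A k j)" and ?n = "real CARD('n)"
  have c: "0 \<le> c" using row_sum_le_nonneg[OF A] .
  have "trace (matrix_pow (M + \<epsilon> *\<^sub>R A) k) = (\<Sum>j\<le>k. \<epsilon> ^ j * ?t j)"
    unfolding matrix_pow_perturbed trace_sum by (simp add: trace_def sum_distrib_left)
  \<comment> \<open>The range is padded with vanishing coefficients so that the orders 0, 1 and 2
    can be split off even when \<open>k < 2\<close>.\<close>
  also have "\<dots> = (\<Sum>j\<le>k + 2. \<epsilon> ^ j * ?t j)"
    by (rule sum.mono_neutral_left) (auto simp: pert_coeff_beyond trace_def)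
  also have "{..k + 2} = insert 0 (insert 1 (insert 2 {3..k + 2}))" by auto
  also have "(\<Sum>j\<in>insert 0 (insert 1 (insert 2 {3..k + 2})). \<epsilon> ^ j * ?t j)
      = trace (matrix_pow M k) + (\<epsilon> * ?t 1 + (\<epsilon>\<^sup>2 * ?t 2 + (\<Sum>j\<in>{3..k + 2}. \<epsilon> ^ j * ?t j)))"
    by (subst sum.insert; simp)+
  finally have "\<bar>trace (matrix_pow (M + \<epsilon> *\<^sub>R A) k) - trace (matrix_pow M k)
      - \<epsilon> * ?t 1 - \<epsilon>\<^sup>2 * ?t 2\<bar> = \<bar>\<Sum>j\<in>{3..k + 2}. \<epsilon> ^ j * ?t j\<bar>"
    by simp
  also have "\<dots> \<le> (\<Sum>j\<in>{3..k + 2}. ?n / \<delta> ^ 3 * \<bar>\<epsilon>\<bar> ^ 3 * (real (k choose j) * (c * \<delta>) ^ j))"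
  proof (intro order_trans[OF sum_abs] sum_mono)
    fix j assume "j \<in> {3..k + 2}"
    then obtain i where j: "j = i + 3" by (auto intro: that[of "j - 3"])
    have "\<bar>\<epsilon> ^ j * ?t j\<bar> \<le> (\<bar>\<epsilon>\<bar> ^ 3 * \<delta> ^ i) * (?n * (real (k choose j) * c ^ j))"
      unfolding abs_mult j power_abs power_add
    proof (rule mult_mono)
      show "\<bar>\<epsilon>\<bar> ^ i * \<bar>\<epsilon>\<bar> ^ 3 \<le> \<bar>\<epsilon>\<bar> ^ 3 * \<delta> ^ i"
        using \<delta> by (subst mult.commute, intro mult_left_mono power_mono) auto
      show "\<bar>?t (i + 3)\<bar> \<le> ?n * (real (k choose (i + 3)) * (c ^ i * c ^ 3))"
        using abs_trace_le[OF row_sum_le_pert_coeff[OF M A, of k "i + 3"]] by (simp add: power_add)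
    qed (use \<delta> in auto)
    also have "\<dots> = ?n / \<delta> ^ 3 * \<bar>\<epsilon>\<bar> ^ 3 * (real (k choose j) * (c * \<delta>) ^ j)"
      using \<delta> by (simp add: j power_add power_mult_distrib field_simps)
    finally show "\<bar>\<epsilon> ^ j * ?t j\<bar> \<le> ?n / \<delta> ^ 3 * \<bar>\<epsilon>\<bar> ^ 3 * (real (k choose j) * (c * \<delta>) ^ j)" .
  qed
  also have "\<dots> \<le> ?n / \<delta> ^ 3 * \<bar>\<epsilon>\<bar> ^ 3 * (\<Sum>j\<le>k. real (k choose j) * (c * \<delta>) ^ j)"
  proof -
    have "(\<Sum>j\<in>{3..k + 2}. real (k choose j) * (c * \<delta>) ^ j) \<le> (\<Sum>j\<le>k + 2. real (k choose j) * (c * \<delta>) ^ j)"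
      using c \<delta> by (intro sum_mono2) auto
    also have "\<dots> = (\<Sum>j\<le>k. real (k choose j) * (c * \<delta>) ^ j)"
      by (rule sum.mono_neutral_right) auto
    finally show ?thesis
      unfolding sum_distrib_left[symmetric] using \<delta> by (intro mult_left_mono) auto
  qed
  also have "(\<Sum>j\<le>k. real (k choose j) * (c * \<delta>) ^ j) = (1 + c * \<delta>) ^ k"
    using binomial_ring[of "c * \<delta>" 1 k] by (simp add: add.commute)
  finally show ?thesis .
qed

definition first_variation :: "real^'n^'n \<Rightarrow> real^'n^'n \<Rightarrow> (complex \<Rightarrow> complex) \<Rightarrow> complex" where
  "first_variation M A f = (\<Sum>k. taylor f k * of_real (trace (pert_coeff M A k 1)))"

text \<open>The coefficient of \<open>\<epsilon>\<^sup>2\<close>, without a factorial, in the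
  expansion of the sum of \<open>f\<close> over the eigenvalues; the normalization by the number of
  vertices is still absent.\<close>

definition second_variation :: "real^'n^'n \<Rightarrow> real^'n^'n \<Rightarrow> (complex \<Rightarrow> complex) \<Rightarrow> complex" where
  "second_variation M A f = (\<Sum>k. taylor f k * of_real (trace (pert_coeff M A k 2)))"

lemma row_sum_le_exists: "\<exists>c. row_sum_le A c"
proof
  show "row_sum_le A (\<Sum>u\<in>UNIV. \<Sum>v\<in>UNIV. \<bar>A $ u $ v\<bar>)"
    unfolding row_sum_le_def by (auto intro!: member_le_sum sum_nonneg)
qed

lemma summable_variation:
  fixes M A :: "real^'n^'n"
  assumes M: "row_sum_le M 1" and f: "f analytic_on cball 0 1" and j: "j \<in> {1, 2}"
  shows "summable (\<lambda>k. taylor f k * of_real (trace (pert_coeff M A k j)))"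
proof -
  obtain c where A: "row_sum_le A c" using row_sum_le_exists by blast
  have "summable (\<lambda>k. (real CARD('n) * c ^ j) * ((real k)\<^sup>2 * norm (taylor f k)))"
    by (intro summable_mult summable_taylor_squares f)
  then show ?thesis
  proof (rule summable_comparison_test'[where N = 0])
    fix k
    have "real (k choose j) \<le> (real k)\<^sup>2"
    proof -
      have "k choose j \<le> k ^ j" by (cases "j \<le> k") (simp_all add: binomial_le_pow binomial_eq_0)
      also have "\<dots> \<le> k ^ 2" using j by (cases k) (auto simp: power2_eq_square)
      finally show ?thesis by (metis of_nat_le_iff of_nat_power)
    qed
    then have "\<bar>trace (pert_coeff M A k j)\<bar> \<le> real CARD('n) * ((real k)\<^sup>2 * c ^ j)"
      using row_sum_le_nonneg[OF A]
      by (intro order_trans[OF abs_trace_le[OF row_sum_le_pert_coeff[OF M A]]] mult_left_mono mult_right_mono) auto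
    from mult_left_mono[OF this, of "norm (taylor f k)"]
    show "norm (taylor f k * of_real (trace (pert_coeff M A k j)))
      \<le> real CARD('n) * c ^ j * ((real k)\<^sup>2 * norm (taylor f k))"
      by (simp add: norm_mult algebra_simps)
  qed
qed

lemma expectation_expansion:
  fixes M A :: "real^'n^'n"
  assumes M: "row_sum_le M 1" and f: "f analytic_on cball 0 1"
  obtains C \<delta> where "\<delta> > 0" "\<And>\<epsilon>. \<bar>\<epsilon>\<bar> \<le> \<delta> \<Longrightarrow>
    norm (of_nat CARD('n) * (measure_pmf.expectation (eigenvalue_distribution (perturbed_matrix M A \<epsilon>)) f
        - measure_pmf.expectation (eigenvalue_distribution (perturbed_matrix M A 0)) f)
      - of_real \<epsilon> * first_variation M A f - of_real (\<epsilon>\<^sup>2) * second_variation M A f) \<le> C * \<bar>\<epsilon>\<bar> ^ 3"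
proof -
  obtain R where R: "R > 1" "\<And>z. norm z < R \<Longrightarrow> (\<lambda>k. taylor f k * z ^ k) sums f z"
    using analytic_on_cball_taylor[OF f] by blast
  obtain c where A: "row_sum_le A c" using row_sum_le_exists by blast
  have c: "0 \<le> c" using row_sum_le_nonneg[OF A] .
  \<comment> \<open>Chosen so that the spectral radius bound \<open>1 + c * \<delta>\<close> stays
    below \<open>R\<close>; adding 1 to \<open>c\<close> covers the case
    \<open>c = 0\<close>.\<close>
  define \<delta> where "\<delta> = (R - 1) / (2 * (c + 1))"
  have \<delta>: "\<delta> > 0" using R c by (simp add: \<delta>_def)
  have "c * \<delta> < (c + 1) * (2 * \<delta>)" using c \<delta> by (intro mult_strict_mono) auto
  also have "\<dots> = R - 1" using c by (simp add: \<delta>_def field_simps)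
  finally have q: "1 + c * \<delta> < R" by simp
  define K where "K = real CARD('n) / \<delta> ^ 3"
  define S where "S = (\<Sum>k. norm (taylor f k) * (1 + c * \<delta>) ^ k)"
  let ?E = "\<lambda>\<epsilon>. measure_pmf.expectation (eigenvalue_distribution (perturbed_matrix M A \<epsilon>)) f"
  let ?t = "\<lambda>\<epsilon> k. trace (matrix_pow (M + \<epsilon> *\<^sub>R A) k)"
  have E: "(\<lambda>k. taylor f k * of_real (?t \<epsilon> k)) sums (of_nat CARD('n) * ?E \<epsilon>)" if "\<bar>\<epsilon>\<bar> \<le> \<delta>" for \<epsilon>
    unfolding perturbed_matrix_eq
  proof (rule expectation_power_series)
    show "row_sum_le (M + \<epsilon> *\<^sub>R A) (1 + \<bar>\<epsilon>\<bar> * c)" by (intro row_sum_le_add row_sum_le_scaleR M A)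
    fix z :: complex assume z: "norm z \<le> 1 + \<bar>\<epsilon>\<bar> * c"
    have "\<bar>\<epsilon>\<bar> * c \<le> \<delta> * c" using that c by (intro mult_right_mono)
    then show "(\<lambda>k. taylor f k * z ^ k) sums f z" using z q by (intro R(2)) (simp add: mult.commute)
  qed
  show thesis
  proof (rule that[OF \<delta>])
    fix \<epsilon> :: real assume \<epsilon>: "\<bar>\<epsilon>\<bar> \<le> \<delta>"
    let ?r = "\<lambda>k. ?t \<epsilon> k - ?t 0 k - \<epsilon> * trace (pert_coeff M A k 1) - \<epsilon>\<^sup>2 * trace (pert_coeff M A k 2)"
    let ?D = "of_nat CARD('n) * ?E \<epsilon> - of_nat CARD('n) * ?E 0
        - of_real \<epsilon> * first_variation M A f - of_real (\<epsilon>\<^sup>2) * second_variation M A f"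
    have "(\<lambda>k. taylor f k * of_real (?t \<epsilon> k) - taylor f k * of_real (?t 0 k)
        - of_real \<epsilon> * (taylor f k * of_real (trace (pert_coeff M A k 1)))
        - of_real (\<epsilon>\<^sup>2) * (taylor f k * of_real (trace (pert_coeff M A k 2)))) sums ?D"
      unfolding first_variation_def second_variation_def
      using \<epsilon> \<delta> by (intro sums_diff E sums_mult summable_sums summable_variation M f) auto
    then have D: "(\<lambda>k. taylor f k * of_real (?r k)) sums ?D"
      by (simp add: algebra_simps)
    have bound: "norm (taylor f k * of_real (?r k)) \<le> K * \<bar>\<epsilon>\<bar> ^ 3 * (norm (taylor f k) * (1 + c * \<delta>) ^ k)" for k
      using mult_left_mono[OF trace_pow_expansion_error[OF M A \<epsilon> \<delta>, of k], of "norm (taylor f k)"]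
      by (simp add: norm_mult K_def algebra_simps del: of_real_diff of_real_mult)
    have summ: "summable (\<lambda>k. norm (taylor f k) * (1 + c * \<delta>) ^ k)"
      by (rule summable_taylor_powers[OF R(2)]) (use c \<delta> q in auto)
    have "norm ?D = norm (\<Sum>k. taylor f k * of_real (?r k))" using sums_unique[OF D] by simp
    also have "\<dots> \<le> (\<Sum>k. K * \<bar>\<epsilon>\<bar> ^ 3 * (norm (taylor f k) * (1 + c * \<delta>) ^ k))"
      by (rule norm_suminf_le[OF bound summable_mult[OF summ]])
    also have "\<dots> = K * \<bar>\<epsilon>\<bar> ^ 3 * S" by (simp add: suminf_mult[OF summ] S_def)
    finally show "norm (of_nat CARD('n) * (?E \<epsilon> - ?E 0)
        - of_real \<epsilon> * first_variation M A f - of_real (\<epsilon>\<^sup>2) * second_variation M A f) \<le> (K * S) * \<bar>\<epsilon>\<bar> ^ 3"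
      by (simp add: algebra_simps)
  qed
qed

text \<open>Division by \<open>\<epsilon>\<^sup>2\<close> turns a first-order term into a pole. If
  \<open>D\<close> has a finite limit, then \<open>\<epsilon> * D\<close> tends both to 0 and to
  \<open>a\<close>. This second part excludes a limit whenever the first variation is nonzero, which
  pins down the value of \<open>Lim\<close> for every realization.\<close>

lemma expansion_with_pole:
  fixes D :: "real \<Rightarrow> complex"
  assumes \<delta>: "\<delta> > 0"
    and D: "\<And>\<epsilon>. \<epsilon> \<noteq> 0 \<Longrightarrow> \<bar>\<epsilon>\<bar> \<le> \<delta> \<Longrightarrow> norm (D \<epsilon> - (a / of_real \<epsilon> + b)) \<le> C * \<bar>\<epsilon>\<bar>"
  shows "a = 0 \<Longrightarrow> (D \<longlongrightarrow> b) (at 0)" and "(D \<longlongrightarrow> l) (at 0) \<Longrightarrow> a = 0"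
proof -
  have ev: "\<forall>\<^sub>F \<epsilon> in at 0. \<epsilon> \<noteq> 0 \<and> \<bar>\<epsilon>\<bar> \<le> \<delta>"
    unfolding eventually_at using \<delta> by (intro exI[of _ \<delta>]) auto
  have lin: "((\<lambda>\<epsilon>. c * \<bar>\<epsilon>\<bar>) \<longlongrightarrow> 0) (at 0)" for c :: real
    by (auto intro!: tendsto_eq_intros)
  show "(D \<longlongrightarrow> b) (at 0)" if "a = 0"
  proof (subst LIM_zero_iff[symmetric], rule Lim_null_comparison[OF _ lin[of C]])
    show "\<forall>\<^sub>F \<epsilon> in at 0. norm (D \<epsilon> - b) \<le> C * \<bar>\<epsilon>\<bar>"
      using ev by eventually_elim (use D that in auto)
  qed
  show "a = 0" if "(D \<longlongrightarrow> l) (at 0)"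
  proof -
    let ?r = "\<lambda>\<epsilon>. of_real \<epsilon> * (D \<epsilon> - (a / of_real \<epsilon> + b))"
    have "(?r \<longlongrightarrow> 0) (at 0)"
    proof (rule Lim_null_comparison)
      show "\<forall>\<^sub>F \<epsilon> in at 0. norm (?r \<epsilon>) \<le> \<bar>\<epsilon>\<bar> * (C * \<bar>\<epsilon>\<bar>)"
        using ev by eventually_elim (use D in \<open>auto simp: norm_mult intro!: mult_left_mono\<close>)
      show "((\<lambda>\<epsilon>. \<bar>\<epsilon>\<bar> * (C * \<bar>\<epsilon>\<bar>)) \<longlongrightarrow> 0) (at (0::real))" by (auto intro!: tendsto_eq_intros)
    qed
    moreover have "((\<lambda>\<epsilon>. of_real \<epsilon> * (D \<epsilon> - b)) \<longlongrightarrow> of_real 0 * (l - b)) (at 0)"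
      by (intro tendsto_intros that)
    ultimately have "((\<lambda>\<epsilon>. of_real \<epsilon> * (D \<epsilon> - b) - ?r \<epsilon>) \<longlongrightarrow> of_real 0 * (l - b) - 0) (at 0)"
      by (intro tendsto_diff)
    moreover have "\<forall>\<^sub>F \<epsilon> in at 0. of_real \<epsilon> * (D \<epsilon> - b) - ?r \<epsilon> = a"
      using ev by eventually_elim (simp add: field_simps)
    ultimately have "((\<lambda>_::real. a) \<longlongrightarrow> of_real 0 * (l - b) - 0) (at 0)"
      by (rule Lim_transform_eventually)
    then show "a = 0" by (simp add: tendsto_const_iff)
  qed
qed

text \<open>A row sums to 1, or to 0 if the vertex has no neighbours, by the convention on division
  by zero.\<close>

lemma row_sum_le_walk_matrix: "row_sum_le (walk_matrix adj) 1"
  unfolding row_sum_le_def walk_matrix_def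
proof
  fix u
  have "(\<Sum>v\<in>UNIV. \<bar>(\<chi> u v. if adj u v then 1 / real (card {w. adj u w}) else 0) $ u $ v\<bar>)
      = (\<Sum>v\<in>UNIV. if adj u v then 1 / real (card {w. adj u w}) else 0)"
    by (intro sum.cong) auto
  also have "\<dots> = real (card {w. adj u w}) * (1 / real (card {w. adj u w}))"
    by (subst sum.If_cases) auto
  also have "\<dots> \<le> 1" by simp
  finally show "(\<Sum>v\<in>UNIV. \<bar>(\<chi> u v. if adj u v then 1 / real (card {w. adj u w}) else 0) $ u $ v\<bar>) \<le> 1" .
qed

text \<open>The expansion controls \<open>n\<close> times the expectation, while the fluctuation
  carries \<open>sqrt n\<close>; hence the quotient by \<open>sqrt n\<close>.\<close>

lemma spectral_fluctuation_limit:
  fixes adj :: "'v::finite \<Rightarrow> 'v \<Rightarrow> bool"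
  assumes f: "f analytic_on cball 0 1"
  shows "first_variation (walk_matrix adj) A f = 0 \<Longrightarrow>
      (spectral_fluctuation adj A f \<longlongrightarrow> second_variation (walk_matrix adj) A f / of_real (sqrt (real CARD('v)))) (at 0)"
    and "(spectral_fluctuation adj A f \<longlongrightarrow> l) (at 0) \<Longrightarrow> first_variation (walk_matrix adj) A f = 0"
proof -
  let ?M = "walk_matrix adj"
  define n s V1 V2 where "n = real CARD('v)" and "s = sqrt n"
    and "V1 = first_variation ?M A f" and "V2 = second_variation ?M A f"
  have s: "s > 0" "s * s = n" by (auto simp: s_def n_def)
  let ?E = "\<lambda>\<epsilon>. measure_pmf.expectation (eigenvalue_distribution (perturbed_matrix ?M A \<epsilon>)) f"
  obtain C \<delta> where \<delta>: "\<delta> > 0" and C: "\<And>\<epsilon>. \<bar>\<epsilon>\<bar> \<le> \<delta> \<Longrightarrow>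
      norm (of_real n * (?E \<epsilon> - ?E 0) - of_real \<epsilon> * V1 - of_real (\<epsilon>\<^sup>2) * V2) \<le> C * \<bar>\<epsilon>\<bar> ^ 3"
    using expectation_expansion[OF row_sum_le_walk_matrix f, of adj A] unfolding V1_def V2_def n_def of_real_of_nat_eq by blast
  have "norm (spectral_fluctuation adj A f \<epsilon> - (V1 / of_real s / of_real \<epsilon> + V2 / of_real s)) \<le> C / s * \<bar>\<epsilon>\<bar>"
    if \<epsilon>: "\<epsilon> \<noteq> 0" "\<bar>\<epsilon>\<bar> \<le> \<delta>" for \<epsilon>
  proof -
    have "spectral_fluctuation adj A f \<epsilon> - (V1 / of_real s / of_real \<epsilon> + V2 / of_real s)
      = (of_real (s * s) * (?E \<epsilon> - ?E 0) - of_real \<epsilon> * V1 - of_real (\<epsilon>\<^sup>2) * V2) / of_real (s * \<epsilon>\<^sup>2)"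
      using \<epsilon> s(1) unfolding spectral_fluctuation_def n_def[symmetric] s_def[symmetric]
      by (simp add: field_simps power2_eq_square)
    also have "norm \<dots> \<le> C * \<bar>\<epsilon>\<bar> ^ 3 / \<bar>s * \<epsilon>\<^sup>2\<bar>"
      unfolding norm_divide norm_of_real s(2) using C[OF \<epsilon>(2)] by (intro divide_right_mono) auto
    also have "\<dots> = C / s * \<bar>\<epsilon>\<bar>"
      using \<epsilon> s(1) by (simp add: abs_mult power2_eq_square power3_eq_cube field_simps)
    finally show ?thesis .
  qed
  note * = expansion_with_pole[of \<delta>, OF \<delta> this]
  show "(spectral_fluctuation adj A f \<longlongrightarrow> second_variation ?M A f / of_real (sqrt (real CARD('v)))) (at 0)"
    if "first_variation ?M A f = 0"
    using *(1) that unfolding s_def n_def V1_def V2_def by simp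
  show "first_variation ?M A f = 0" if "(spectral_fluctuation adj A f \<longlongrightarrow> l) (at 0)"
    using *(2) that s(1) unfolding V1_def by simp
qed

text \<open>
  On the null set where the first-order term does not vanish there is no limit, and there the value
  of \<^const>\<open>Lim\<close> is one and the same junk constant; hence the noise is measurable everywhere.
\<close>

lemma spectral_noise_eq:
  fixes adj :: "'v::finite \<Rightarrow> 'v \<Rightarrow> bool"
  assumes "f analytic_on cball 0 1"
  shows "spectral_noise adj A f = (if first_variation (walk_matrix adj) A f = 0
    then second_variation (walk_matrix adj) A f / of_real (sqrt (real CARD('v))) else (THE l. False))"
proof (cases "first_variation (walk_matrix adj) A f = 0")
  case True
  then show ?thesis
    using spectral_fluctuation_limit(1)[OF assms True] by (simp add: spectral_noise_def tendsto_Lim)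
next
  case False
  then have "(\<lambda>l. (spectral_fluctuation adj A f \<longlongrightarrow> l) (at 0)) = (\<lambda>l. False)"
    using spectral_fluctuation_limit(2)[OF assms] by blast
  with False show ?thesis by (simp add: spectral_noise_def Topological_Spaces.Lim_def)
qed

section \<open>The second variation as a quadratic form\<close>

text \<open>The coefficient of \<open>A $ v $ x * A $ w $ y\<close> in
  \<open>Y_coeff adj A k v w\<close>: a closed tour that jumps from \<open>v\<close> to
  \<open>x\<close>, walks to \<open>w\<close> in \<open>l\<close> steps, jumps to \<open>y\<close>
  and walks back to \<open>v\<close>.\<close>

definition walk_kernel :: "('v::finite \<Rightarrow> 'v \<Rightarrow> bool) \<Rightarrow> nat \<Rightarrow> 'v \<Rightarrow> 'v \<Rightarrow> 'v \<Rightarrow> 'v \<Rightarrow> real" where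
  "walk_kernel adj k v w x y =
    (\<Sum>l<k - 1. matrix_pow (walk_matrix adj) l $ x $ w * matrix_pow (walk_matrix adj) (k - 2 - l) $ y $ v)"

text \<open>The whole Taylor series is absorbed into this deterministic kernel; the weight
  \<open>k\<close> is the one in \<open>trace_pert_coeff_2\<close>, whose factor 1/2 is kept
  outside.\<close>

definition pair_kernel ::
    "('v::finite \<Rightarrow> 'v \<Rightarrow> bool) \<Rightarrow> (complex \<Rightarrow> complex) \<Rightarrow> 'v \<Rightarrow> 'v \<Rightarrow> 'v \<Rightarrow> 'v \<Rightarrow> complex" where
  "pair_kernel adj f v w x y = (\<Sum>k. of_nat k * taylor f k * of_real (walk_kernel adj k v w x y))"

definition pair_form ::
    "('v::finite \<Rightarrow> 'v \<Rightarrow> bool) \<Rightarrow> real^'v^'v \<Rightarrow> (complex \<Rightarrow> complex) \<Rightarrow> 'v \<Rightarrow> 'v \<Rightarrow> complex" where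
  "pair_form adj A f v w = (\<Sum>x\<in>UNIV. \<Sum>y\<in>UNIV. of_real (A $ v $ x * A $ w $ y) * pair_kernel adj f v w x y)"

text \<open>For \<open>k < 2\<close> both index sets are empty, so truncated subtraction does no
  harm.\<close>

lemma Y_coeff_sum:
  "Y_coeff adj A k v w = (\<Sum>l<k - 1. (A ** matrix_pow (walk_matrix adj) l) $ v $ w *
      (A ** matrix_pow (walk_matrix adj) (k - 2 - l)) $ w $ v)"
  unfolding Y_coeff_def
  by (rule sum.reindex_bij_witness[of _ "\<lambda>l. (l, k - 2 - l)" fst]) auto

lemma Y_coeff_commute: "Y_coeff adj A k v w = Y_coeff adj A k w v"
  unfolding Y_coeff_def
  by (rule sum.reindex_bij_witness[of _ prod.swap prod.swap]) (auto simp: mult.commute)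

lemma Y_coeff_kernel:
  "Y_coeff adj A k v w = (\<Sum>x\<in>UNIV. \<Sum>y\<in>UNIV. A $ v $ x * A $ w $ y * walk_kernel adj k v w x y)"
proof -
  let ?P = "matrix_pow (walk_matrix adj)"
  have "Y_coeff adj A k v w = (\<Sum>l<k - 1. \<Sum>x\<in>UNIV. \<Sum>y\<in>UNIV.
      A $ v $ x * A $ w $ y * (?P l $ x $ w * ?P (k - 2 - l) $ y $ v))"
    by (simp add: Y_coeff_sum matrix_matrix_mult_def sum_product mult_ac)
  also have "\<dots> = (\<Sum>x\<in>UNIV. \<Sum>l<k - 1. \<Sum>y\<in>UNIV.
      A $ v $ x * A $ w $ y * (?P l $ x $ w * ?P (k - 2 - l) $ y $ v))"
    by (rule sum.swap)
  also have "\<dots> = (\<Sum>x\<in>UNIV. \<Sum>y\<in>UNIV. \<Sum>l<k - 1.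
      A $ v $ x * A $ w $ y * (?P l $ x $ w * ?P (k - 2 - l) $ y $ v))"
    by (rule sum.cong[OF refl], rule sum.swap)
  finally show ?thesis by (simp add: walk_kernel_def sum_distrib_left)
qed

lemma abs_walk_kernel_le: "\<bar>walk_kernel adj k v w x y\<bar> \<le> real k"
proof -
  have entry: "\<bar>matrix_pow (walk_matrix adj) l $ a $ b\<bar> \<le> 1" for l a b
    by (intro row_sum_le_entry row_sum_le_matrix_pow row_sum_le_walk_matrix)
  have "\<bar>walk_kernel adj k v w x y\<bar> \<le> (\<Sum>l<k - 1. 1 * 1)"
    unfolding walk_kernel_def
    by (intro order_trans[OF sum_abs] sum_mono) (simp add: abs_mult mult_le_one entry)
  then show ?thesis by simp
qed

lemma summable_pair_kernel:
  assumes "f analytic_on cball 0 1"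
  shows "summable (\<lambda>k. norm (of_nat k * taylor f k * of_real (walk_kernel adj k v w x y)))"
proof (rule summable_comparison_test'[OF summable_taylor_squares[OF assms], where N = 0])
  fix k
  show "norm (norm (of_nat k * taylor f k * of_real (walk_kernel adj k v w x y))) \<le> (real k)\<^sup>2 * norm (taylor f k)"
    using mult_left_mono[OF abs_walk_kernel_le[of adj k v w x y], of "real k * norm (taylor f k)"]
    by (simp add: norm_mult power2_eq_square mult_ac)
qed

lemma pair_form_sums:
  assumes "f analytic_on cball 0 1"
  shows "(\<lambda>k. of_nat k * taylor f k * of_real (Y_coeff adj A k v w)) sums pair_form adj A f v w"
proof -
  have "(\<lambda>k. \<Sum>x\<in>UNIV. \<Sum>y\<in>UNIV. of_real (A $ v $ x * A $ w $ y) *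
      (of_nat k * taylor f k * of_real (walk_kernel adj k v w x y))) sums pair_form adj A f v w"
    unfolding pair_form_def pair_kernel_def
    by (intro sums_sum sums_mult summable_sums summable_norm_cancel[OF summable_pair_kernel] assms)
  moreover have "(\<Sum>x\<in>UNIV. \<Sum>y\<in>UNIV. of_real (A $ v $ x * A $ w $ y) *
      (of_nat k * taylor f k * of_real (walk_kernel adj k v w x y)))
      = of_nat k * taylor f k * of_real (Y_coeff adj A k v w)" for k
    unfolding Y_coeff_kernel of_real_sum sum_distrib_left
    by (intro sum.cong refl) (simp add: mult_ac)
  ultimately show ?thesis by simp
qed

text \<open>Written out in entries, the trace of a product of two matrices is a sum over ordered
  pairs of vertices; summing over the gap \<open>l\<close> produces \<open>Y_coeff\<close>.\<close>

lemma second_variation_eq: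
  assumes f: "f analytic_on cball 0 1"
  shows "second_variation (walk_matrix adj) A f = 1 / 2 * (\<Sum>v\<in>UNIV. \<Sum>w\<in>UNIV. pair_form adj A f v w)"
proof -
  let ?P = "matrix_pow (walk_matrix adj)"
  have "(\<lambda>k. 1 / 2 * (\<Sum>v\<in>UNIV. \<Sum>w\<in>UNIV. of_nat k * taylor f k * of_real (Y_coeff adj A k v w)))
      sums (1 / 2 * (\<Sum>v\<in>UNIV. \<Sum>w\<in>UNIV. pair_form adj A f v w))"
    by (intro sums_mult sums_sum pair_form_sums f)
  moreover have "taylor f k * of_real (trace (pert_coeff (walk_matrix adj) A k 2))
      = 1 / 2 * (\<Sum>v\<in>UNIV. \<Sum>w\<in>UNIV. of_nat k * taylor f k * of_real (Y_coeff adj A k v w))" for k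
  proof -
    have "(\<Sum>l<k - 1. trace (A ** ?P l ** (A ** ?P (k - 2 - l)))) = (\<Sum>v\<in>UNIV. \<Sum>w\<in>UNIV. Y_coeff adj A k v w)"
    proof -
      have "(\<Sum>l<k - 1. trace (A ** ?P l ** (A ** ?P (k - 2 - l))))
        = (\<Sum>l<k - 1. \<Sum>v\<in>UNIV. \<Sum>w\<in>UNIV. (A ** ?P l) $ v $ w * (A ** ?P (k - 2 - l)) $ w $ v)"
        by (intro sum.cong refl) (simp add: trace_def matrix_matrix_mult_def[of "A ** _"])
      also have "\<dots> = (\<Sum>v\<in>UNIV. \<Sum>l<k - 1. \<Sum>w\<in>UNIV. (A ** ?P l) $ v $ w * (A ** ?P (k - 2 - l)) $ w $ v)"
        by (rule sum.swap)
      also have "\<dots> = (\<Sum>v\<in>UNIV. \<Sum>w\<in>UNIV. \<Sum>l<k - 1. (A ** ?P l) $ v $ w * (A ** ?P (k - 2 - l)) $ w $ v)"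
        by (rule sum.cong[OF refl], rule sum.swap)
      finally show ?thesis by (simp only: Y_coeff_sum)
    qed
    then have "trace (pert_coeff (walk_matrix adj) A k 2) = real k / 2 * (\<Sum>v\<in>UNIV. \<Sum>w\<in>UNIV. Y_coeff adj A k v w)"
      by (simp only: trace_pert_coeff_2)
    moreover have "(\<Sum>v\<in>UNIV. \<Sum>w\<in>UNIV. of_nat k * taylor f k * of_real (Y_coeff adj A k v w))
        = of_nat k * taylor f k * of_real (\<Sum>v\<in>UNIV. \<Sum>w\<in>UNIV. Y_coeff adj A k v w)"
      unfolding of_real_sum sum_distrib_left ..
    ultimately show ?thesis by (simp only: of_real_mult of_real_divide of_real_of_nat_eq) simp
  qed
  ultimately show ?thesis unfolding second_variation_def by (simp only: sums_iff)
qed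

section \<open>Unordered series over pairs of indices\<close>

lemma has_sum_sum_functions:
  fixes F :: "'i \<Rightarrow> 'a \<Rightarrow> 'b::{topological_comm_monoid_add, comm_monoid_add}"
  assumes "\<And>i. i \<in> I \<Longrightarrow> (F i has_sum S i) A"
  shows "((\<lambda>x. \<Sum>i\<in>I. F i x) has_sum (\<Sum>i\<in>I. S i)) A"
  using assms by (induction I rule: infinite_finite_induct) (auto intro: has_sum_add)

text \<open>Absolute convergence of the factors gives unconditional summability over pairs, as the
  unordered \<open>infsum\<close> in \<open>H_form\<close> requires; the value is then found row by
  row.\<close>

lemma has_sum_mult_product:
  fixes p q :: "nat \<Rightarrow> complex"
  assumes p: "summable (\<lambda>i. norm (p i))" and q: "summable (\<lambda>j. norm (q j))"
  shows "((\<lambda>(i, j). p i * q j) has_sum ((\<Sum>i. p i) * (\<Sum>j. q j))) UNIV"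
proof -
  have P: "(p has_sum (\<Sum>i. p i)) UNIV" and Q: "(q has_sum (\<Sum>j. q j)) UNIV"
    using p q by (auto intro!: norm_summable_imp_has_sum summable_sums summable_norm_cancel[OF p] summable_norm_cancel[OF q])
  have "Infinite_Sum.abs_summable_on (\<lambda>(i, j). p i * q j) (UNIV \<times> UNIV)"
    unfolding abs_summable_equivalent
    by (rule Infinite_Set_Sum.abs_summable_on_product)
      (use p q in \<open>auto simp flip: abs_summable_equivalent intro!: norm_summable_imp_summable_on\<close>)
  then have summ: "(\<lambda>(i, j). p i * q j) summable_on UNIV \<times> UNIV"
    by (rule abs_summable_summable)
  have "((\<lambda>(i, j). p i * q j) has_sum ((\<Sum>i. p i) * (\<Sum>j. q j))) (UNIV \<times> UNIV)"
    by (rule has_sum_SigmaI[where g = "\<lambda>i. p i * (\<Sum>j. q j)"])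
      (use summ P Q in \<open>auto intro: has_sum_cmult_right has_sum_cmult_left\<close>)
  then show ?thesis by simp
qed

section \<open>Symmetry under automorphisms\<close>

lemma bij_automorphism: "\<pi> \<in> automorphisms adj \<Longrightarrow> bij \<pi>"
  by (simp add: automorphisms_def)

lemma sum_automorphism:
  "\<pi> \<in> automorphisms adj \<Longrightarrow> (\<Sum>x\<in>UNIV. F (\<pi> x)) = (\<Sum>x\<in>UNIV. F x)"
  by (rule sum.reindex_bij_betw) (simp add: bij_automorphism)

lemma walk_matrix_automorphism:
  assumes "\<pi> \<in> automorphisms adj"
  shows "walk_matrix adj $ \<pi> u $ \<pi> v = walk_matrix adj $ u $ v"
proof -
  have adj: "adj (\<pi> x) (\<pi> y) \<longleftrightarrow> adj x y" for x y
    using assms by (simp add: automorphisms_def)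
  have "{w. adj (\<pi> u) w} = \<pi> ` {w. adj u w}"
  proof (intro Set.set_eqI iffI)
    fix w assume "w \<in> {w. adj (\<pi> u) w}"
    moreover obtain z where "w = \<pi> z" using bij_automorphism[OF assms] by (meson bij_pointE)
    ultimately show "w \<in> \<pi> ` {w. adj u w}" by (simp add: adj)
  qed (auto simp: adj)
  then have "card {w. adj (\<pi> u) w} = card {w. adj u w}"
    using bij_automorphism[OF assms] by (simp add: card_image bij_def inj_on_subset[of \<pi> UNIV])
  then show ?thesis by (simp add: walk_matrix_def adj)
qed

lemma matrix_pow_automorphism:
  assumes "\<pi> \<in> automorphisms adj"
  shows "matrix_pow (walk_matrix adj) k $ \<pi> u $ \<pi> v = matrix_pow (walk_matrix adj) k $ u $ v"
proof (induction k arbitrary: u)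
  case 0
  then show ?case
    using bij_automorphism[OF assms] by (auto simp: Finite_Cartesian_Product.mat_def bij_def inj_eq)
next
  case (Suc k)
  have "matrix_pow (walk_matrix adj) (Suc k) $ \<pi> u $ \<pi> v
      = (\<Sum>x\<in>UNIV. walk_matrix adj $ \<pi> u $ \<pi> x * matrix_pow (walk_matrix adj) k $ \<pi> x $ \<pi> v)"
    using sum_automorphism[OF assms, of "\<lambda>x. walk_matrix adj $ \<pi> u $ x * matrix_pow (walk_matrix adj) k $ x $ \<pi> v"]
    by (simp add: matrix_matrix_mult_def)
  then show ?case by (simp add: Suc walk_matrix_automorphism[OF assms] matrix_matrix_mult_def)
qed

lemma pair_kernel_automorphism:
  "\<pi> \<in> automorphisms adj \<Longrightarrow> pair_kernel adj f (\<pi> v) (\<pi> w) (\<pi> x) (\<pi> y) = pair_kernel adj f v w x y"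
  by (simp add: pair_kernel_def walk_kernel_def matrix_pow_automorphism)

text \<open>The stabilizer fixes column \<open>u\<close> of every power of the walk matrix, so averaging over it kills the diagonal.\<close>

lemma diagonal_zero:
  assumes "\<And>v. (\<Sum>\<pi>\<in>stabilizer adj u. A $ u $ \<pi> v) = 0"
  shows "(A ** matrix_pow (walk_matrix adj) k) $ u $ u = 0"
proof -
  let ?P = "matrix_pow (walk_matrix adj) k" and ?S = "stabilizer adj u"
  have fin: "finite ?S" by simp
  \<comment> \<open>A nonempty stabilizer allows division by its order at the end.\<close>
  have "id \<in> ?S" by (simp add: stabilizer_def automorphisms_def)
  then have card: "card ?S \<noteq> 0" using fin by auto
  have "(A ** ?P) $ u $ u = (\<Sum>v\<in>UNIV. A $ u $ \<pi> v * ?P $ v $ u)" if "\<pi> \<in> ?S" for \<pi>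
  proof -
    have \<pi>: "\<pi> \<in> automorphisms adj" "\<pi> u = u" using that by (auto simp: stabilizer_def)
    have "(A ** ?P) $ u $ u = (\<Sum>v\<in>UNIV. A $ u $ \<pi> v * ?P $ \<pi> v $ \<pi> u)"
      unfolding \<pi>(2) using sum_automorphism[OF \<pi>(1), of "\<lambda>v. A $ u $ v * ?P $ v $ u"]
      by (simp add: matrix_matrix_mult_def)
    then show ?thesis by (simp only: matrix_pow_automorphism[OF \<pi>(1)])
  qed
  then have "(\<Sum>\<pi>\<in>?S. (A ** ?P) $ u $ u) = (\<Sum>\<pi>\<in>?S. \<Sum>v\<in>UNIV. A $ u $ \<pi> v * ?P $ v $ u)"
    by (rule sum.cong[OF refl])
  also have "\<dots> = (\<Sum>v\<in>UNIV. (\<Sum>\<pi>\<in>?S. A $ u $ \<pi> v) * ?P $ v $ u)"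
    by (subst sum.swap) (simp add: sum_distrib_right)
  also have "\<dots> = 0" by (simp add: assms)
  finally show ?thesis using card by simp
qed

lemma first_variation_zero:
  assumes "\<And>u v. (\<Sum>\<pi>\<in>stabilizer adj u. A $ u $ \<pi> v) = 0"
  shows "first_variation (walk_matrix adj) A f = 0"
proof -
  have "trace (pert_coeff (walk_matrix adj) A k 1) = 0" for k
    unfolding trace_pert_coeff_1 by (simp add: trace_def diagonal_zero[OF assms])
  then show ?thesis by (simp add: first_variation_def)
qed

text \<open>For equal vertices \<open>Y_coeff\<close> is built from products of diagonal entries,
  each of which vanishes.\<close>

lemma pair_form_diagonal_zero:
  assumes "\<And>v. (\<Sum>\<pi>\<in>stabilizer adj u. A $ u $ \<pi> v) = 0" and f: "f analytic_on cball 0 1"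
  shows "pair_form adj A f u u = 0"
  using pair_form_sums[OF f, of adj A u u] diagonal_zero[OF assms(1)]
  by (simp add: Y_coeff_sum sums_iff)

lemma pair_form_commute:
  assumes "f analytic_on cball 0 1"
  shows "pair_form adj A f v w = pair_form adj A f w v"
  using pair_form_sums[OF assms, of adj A v w] pair_form_sums[OF assms, of adj A w v]
  by (simp add: Y_coeff_commute[of adj A _ v w] sums_unique2)

section \<open>Moments of the noise\<close>

text \<open>The common shape of \<open>pair_form\<close> and \<open>Y_coeff\<close>, bilinear in two
  rows with an arbitrary kernel, so that moments are computed once for both sides of the covariance
  identity.\<close>

definition row_form ::
    "('v::finite \<Rightarrow> 'v \<Rightarrow> complex) \<Rightarrow> 'v \<Rightarrow> 'v \<Rightarrow> real^'v^'v \<Rightarrow> complex" where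
  "row_form K v w A = (\<Sum>p\<in>UNIV. of_real (A $ v $ fst p * A $ w $ snd p) * K (fst p) (snd p))"

lemma row_form_double_sum:
  "row_form K v w A = (\<Sum>x\<in>UNIV. \<Sum>y\<in>UNIV. of_real (A $ v $ x * A $ w $ y) * K x y)"
  by (simp add: row_form_def sum.cartesian_product case_prod_unfold)

lemma pair_form_row_form: "pair_form adj A f v w = row_form (pair_kernel adj f v w) v w A"
  by (simp only: pair_form_def row_form_double_sum)

lemma Y_coeff_row_form:
  "of_real (Y_coeff adj A k v w) = row_form (\<lambda>x y. of_real (walk_kernel adj k v w x y)) v w A"
  by (simp add: Y_coeff_kernel row_form_double_sum)

context random_environment
begin

section \<open>Moments of products of entries\<close>

lemma row_measurable [measurable]: "(\<lambda>\<omega>. B \<omega> $ u) \<in> borel_measurable P"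
  using indep_rows by (simp add: indep_vars_def)

lemma vec_nth_measurable [measurable]: "(\<lambda>r. r $ x) \<in> borel_measurable (borel :: (real^'v) measure)"
  by (intro borel_measurable_continuous_onI continuous_intros)

lemma entry_measurable [measurable]: "(\<lambda>\<omega>. B \<omega> $ u $ v) \<in> borel_measurable P"
  using measurable_compose[OF row_measurable vec_nth_measurable] .

lemma entry_bounded: obtains c where "0 \<le> c" "AE \<omega> in P. \<forall>u v. \<bar>B \<omega> $ u $ v\<bar> \<le> c"
proof -
  obtain c1 where c1: "AE \<omega> in P. \<forall>u v. \<bar>B \<omega> $ u $ v\<bar> \<le> c1 * walk_matrix adj $ u $ v"
    using bounded by blast
  have "AE \<omega> in P. \<forall>u v. \<bar>B \<omega> $ u $ v\<bar> \<le> \<bar>c1\<bar>"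
    using c1
  proof eventually_elim
    case (elim \<omega>)
    show ?case
    proof (intro allI)
      fix u v
      have "\<bar>B \<omega> $ u $ v\<bar> \<le> \<bar>c1 * walk_matrix adj $ u $ v\<bar>" using elim by (meson abs_ge_self order_trans)
      also have "\<dots> \<le> \<bar>c1\<bar> * 1"
        unfolding abs_mult by (intro mult_left_mono row_sum_le_entry row_sum_le_walk_matrix) auto
      finally show "\<bar>B \<omega> $ u $ v\<bar> \<le> \<bar>c1\<bar>" by simp
    qed
  qed
  then show thesis using that[of "\<bar>c1\<bar>"] by simp
qed

lemma entry_integrable:
  "integrable P (\<lambda>\<omega>. B \<omega> $ v $ x)"
  "integrable P (\<lambda>\<omega>. B \<omega> $ v $ x * B \<omega> $ w $ y)"
  "integrable P (\<lambda>\<omega>. B \<omega> $ v $ x * B \<omega> $ w $ y * (B \<omega> $ v' $ x' * B \<omega> $ w' $ y'))"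
proof -
  obtain c where c: "0 \<le> c" "AE \<omega> in P. \<forall>u v. \<bar>B \<omega> $ u $ v\<bar> \<le> c" by (rule entry_bounded)
  show "integrable P (\<lambda>\<omega>. B \<omega> $ v $ x)"
    by (rule integrable_const_bound[of _ c]) (use c(2) in \<open>eventually_elim, simp\<close>, measurable)
  show "integrable P (\<lambda>\<omega>. B \<omega> $ v $ x * B \<omega> $ w $ y)"
    by (rule integrable_const_bound[of _ "c * c"])
      (use c(2) in \<open>eventually_elim, use c(1) in \<open>auto simp: abs_mult intro!: mult_mono\<close>\<close>, measurable)
  show "integrable P (\<lambda>\<omega>. B \<omega> $ v $ x * B \<omega> $ w $ y * (B \<omega> $ v' $ x' * B \<omega> $ w' $ y'))"
    by (rule integrable_const_bound[of _ "c * c * (c * c)"])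
      (use c(2) in \<open>eventually_elim, use c(1) in \<open>auto simp: abs_mult intro!: mult_mono\<close>\<close>, measurable)
qed

text \<open>Off the edges the walk matrix is zero, so the entry vanishes almost surely.\<close>

lemma entry_mean: "expectation (\<lambda>\<omega>. B \<omega> $ u $ v) = 0"
proof (cases "adj u v")
  case False
  obtain c1 where "AE \<omega> in P. \<forall>u v. \<bar>B \<omega> $ u $ v\<bar> \<le> c1 * walk_matrix adj $ u $ v"
    using bounded by blast
  then have "AE \<omega> in P. B \<omega> $ u $ v = 0"
  proof eventually_elim
    case (elim \<omega>)
    then have "\<bar>B \<omega> $ u $ v\<bar> \<le> c1 * walk_matrix adj $ u $ v" by blast
    then show ?case using False by (simp add: walk_matrix_def)
  qed
  then show ?thesis by (rule integral_eq_zero_AE)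
qed (rule mean_zero)

text \<open>Independence enters the moment computations only here, always as a product over all
  rows.\<close>

lemma expectation_prod_rows:
  assumes "\<And>u. F u \<in> borel_measurable borel" "\<And>u. integrable P (\<lambda>\<omega>. F u (B \<omega> $ u))"
  shows "expectation (\<lambda>\<omega>. \<Prod>u\<in>UNIV. F u (B \<omega> $ u) :: real) = (\<Prod>u\<in>UNIV. expectation (\<lambda>\<omega>. F u (B \<omega> $ u)))"
  by (rule indep_vars_lebesgue_integral[OF finite indep_vars_compose2[OF indep_rows]]) (use assms in auto)

lemma expectation_two_rows:
  assumes "v \<noteq> w"
  shows "expectation (\<lambda>\<omega>. B \<omega> $ v $ x * B \<omega> $ w $ y) = 0"
proof -
  \<comment> \<open>Rows that do not occur contribute the constant 1.\<close>
  let ?F = "\<lambda>u r. (if u = v then r $ x else 1) * (if u = w then r $ y else (1::real))"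
  have "expectation (\<lambda>\<omega>. B \<omega> $ v $ x * B \<omega> $ w $ y) = expectation (\<lambda>\<omega>. \<Prod>u\<in>UNIV. ?F u (B \<omega> $ u))"
    by (simp add: prod.distrib)
  also have "\<dots> = (\<Prod>u\<in>UNIV. expectation (\<lambda>\<omega>. ?F u (B \<omega> $ u)))"
  proof (rule expectation_prod_rows)
    fix u
    show "?F u \<in> borel_measurable borel" by measurable
    show "integrable P (\<lambda>\<omega>. ?F u (B \<omega> $ u))"
    proof (cases "u = v \<or> u = w")
      case True
      then show ?thesis using assms entry_integrable(1) by (elim disjE) simp_all
    next
      case False
      then show ?thesis by simp
    qed
  qed
  also have "\<dots> = 0"
    by (rule prod_zero, simp, rule bexI[of _ v]) (use assms in \<open>auto simp: entry_mean\<close>)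
  finally show ?thesis .
qed

text \<open>One formula for every coincidence pattern of the four row indices: the factor of row
  \<open>u\<close> collects exactly the entries taken from that row, so coinciding rows are merged
  into one expectation.\<close>

lemma expectation_four_rows:
  "expectation (\<lambda>\<omega>. B \<omega> $ v $ x * B \<omega> $ w $ y * (B \<omega> $ v' $ x' * B \<omega> $ w' $ y'))
    = (\<Prod>u\<in>UNIV. expectation (\<lambda>\<omega>. (if u = v then B \<omega> $ u $ x else 1) * (if u = w then B \<omega> $ u $ y else 1)
        * ((if u = v' then B \<omega> $ u $ x' else 1) * (if u = w' then B \<omega> $ u $ y' else 1))))"
proof -
  let ?F = "\<lambda>u r. (if u = v then r $ x else 1) * (if u = w then r $ y else (1::real))
        * ((if u = v' then r $ x' else 1) * (if u = w' then r $ y' else 1))"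
  have "expectation (\<lambda>\<omega>. B \<omega> $ v $ x * B \<omega> $ w $ y * (B \<omega> $ v' $ x' * B \<omega> $ w' $ y'))
      = expectation (\<lambda>\<omega>. \<Prod>u\<in>UNIV. ?F u (B \<omega> $ u))"
    by (simp add: prod.distrib)
  also have "\<dots> = (\<Prod>u\<in>UNIV. expectation (\<lambda>\<omega>. ?F u (B \<omega> $ u)))"
  proof (rule expectation_prod_rows)
    fix u
    obtain c where c: "0 \<le> c" "AE \<omega> in P. \<forall>u v. \<bar>B \<omega> $ u $ v\<bar> \<le> c" by (rule entry_bounded)
    show m: "?F u \<in> borel_measurable borel" by measurable
    show "integrable P (\<lambda>\<omega>. ?F u (B \<omega> $ u))"
    proof (rule integrable_const_bound)
      let ?c = "max 1 c"
      show "AE \<omega> in P. norm (?F u (B \<omega> $ u)) \<le> ?c * ?c * (?c * ?c)"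
        using c(2)
      proof eventually_elim
        case (elim \<omega>)
        have b: "\<bar>B \<omega> $ u $ z\<bar> \<le> ?c" for z using elim by (meson le_max_iff_disj)
        have "\<bar>if Q then B \<omega> $ u $ z else 1\<bar> \<le> ?c" for Q z using b[of z] by auto
        then show ?case unfolding real_norm_def abs_mult by (intro mult_mono) auto
      qed
      show "(\<lambda>\<omega>. ?F u (B \<omega> $ u)) \<in> borel_measurable P"
        by (rule measurable_compose[OF row_measurable m])
    qed
  qed
  finally show ?thesis .
qed

lemma expectation_four_rows_zero:
  assumes "v \<noteq> w" "v' \<noteq> w'" "{v, w} \<noteq> {v', w'}"
  shows "expectation (\<lambda>\<omega>. B \<omega> $ v $ x * B \<omega> $ w $ y * (B \<omega> $ v' $ x' * B \<omega> $ w' $ y')) = 0"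
proof -
  \<comment> \<open>Distinct two-element sets each have an element outside the other. The row
    \<open>u\<close> thus occurs exactly once, and its factor is the mean of a single entry.\<close>
  obtain u where u: "u \<in> {v, w}" "u \<notin> {v', w'}" using assms by blast
  show ?thesis
    unfolding expectation_four_rows
    by (rule prod_zero, simp, rule bexI[of _ u]) (use u assms(1) in \<open>auto simp: entry_mean\<close>)
qed

definition cov :: "'v \<Rightarrow> 'v \<Rightarrow> 'v \<Rightarrow> real" where
  "cov u x x' = expectation (\<lambda>\<omega>. B \<omega> $ u $ x * B \<omega> $ u $ x')"

lemma expectation_four_rows_same:
  assumes "v \<noteq> w"
  shows "expectation (\<lambda>\<omega>. B \<omega> $ v $ x * B \<omega> $ w $ y * (B \<omega> $ v $ x' * B \<omega> $ w $ y'))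
    = cov v x x' * cov w y y'"
proof -
  have "expectation (\<lambda>\<omega>. B \<omega> $ v $ x * B \<omega> $ w $ y * (B \<omega> $ v $ x' * B \<omega> $ w $ y'))
      = (\<Prod>u\<in>UNIV. (if u = v then cov v x x' else 1) * (if u = w then cov w y y' else 1))"
    unfolding expectation_four_rows
    by (rule prod.cong[OF refl]) (use assms in \<open>auto simp: cov_def prob_space\<close>)
  then show ?thesis by (simp add: prod.distrib)
qed

section \<open>Moments of row forms\<close>

lemma row_form_integrable: "integrable P (\<lambda>\<omega>. row_form K v w (B \<omega>))"
  unfolding row_form_def by (intro Bochner_Integration.integrable_sum integrable_mult_left integrable_of_real entry_integrable)

lemma expectation_row_form:
  assumes "v \<noteq> w"
  shows "(\<integral>\<omega>. row_form K v w (B \<omega>) \<partial>P) = 0"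
proof -
  have "(\<integral>\<omega>. row_form K v w (B \<omega>) \<partial>P)
      = (\<Sum>p\<in>UNIV. of_real (expectation (\<lambda>\<omega>. B \<omega> $ v $ fst p * B \<omega> $ w $ snd p)) * K (fst p) (snd p))"
    unfolding row_form_def
    by (subst Bochner_Integration.integral_sum)
      (auto intro!: integrable_mult_left integrable_of_real entry_integrable simp del: of_real_mult)
  then show ?thesis by (simp add: expectation_two_rows[OF assms])
qed

lemma row_form_mult:
  "row_form K v w A * row_form K' v' w' A = (\<Sum>p\<in>UNIV. \<Sum>q\<in>UNIV.
    of_real (A $ v $ fst p * A $ w $ snd p * (A $ v' $ fst q * A $ w' $ snd q)) * (K (fst p) (snd p) * K' (fst q) (snd q)))"
  unfolding row_form_def sum_product by (simp add: mult_ac)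

lemma row_form_mult_integrable: "integrable P (\<lambda>\<omega>. row_form K v w (B \<omega>) * row_form K' v' w' (B \<omega>))"
  unfolding row_form_mult
  by (intro Bochner_Integration.integrable_sum integrable_mult_left integrable_of_real entry_integrable)

lemma expectation_row_form_mult:
  "(\<integral>\<omega>. row_form K v w (B \<omega>) * row_form K' v' w' (B \<omega>) \<partial>P) = (\<Sum>p\<in>UNIV. \<Sum>q\<in>UNIV.
    of_real (expectation (\<lambda>\<omega>. B \<omega> $ v $ fst p * B \<omega> $ w $ snd p * (B \<omega> $ v' $ fst q * B \<omega> $ w' $ snd q)))
      * (K (fst p) (snd p) * K' (fst q) (snd q)))"
proof -
  have *: "integrable P (\<lambda>\<omega>. complex_of_real (B \<omega> $ v $ fst p * B \<omega> $ w $ snd p * (B \<omega> $ v' $ fst q * B \<omega> $ w' $ snd q)) * z)" for p q z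
    by (intro integrable_mult_left integrable_of_real entry_integrable)
  show ?thesis
    unfolding row_form_mult
    by (simp add: Bochner_Integration.integral_sum Bochner_Integration.integrable_sum * del: of_real_mult)
qed

text \<open>The expected product of two row forms on the same two distinct rows, deterministic and
  bilinear in the kernels.\<close>

definition cov_form :: "('v \<Rightarrow> 'v \<Rightarrow> complex) \<Rightarrow> ('v \<Rightarrow> 'v \<Rightarrow> complex) \<Rightarrow> 'v \<Rightarrow> 'v \<Rightarrow> complex" where
  "cov_form K K' v w = (\<Sum>p\<in>UNIV. \<Sum>q\<in>UNIV.
    of_real (cov v (fst p) (fst q) * cov w (snd p) (snd q)) * (K (fst p) (snd p) * K' (fst q) (snd q)))"

lemma expectation_row_form_same:
  assumes "v \<noteq> w"
  shows "(\<integral>\<omega>. row_form K v w (B \<omega>) * row_form K' v w (B \<omega>) \<partial>P) = cov_form K K' v w"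
  by (simp only: expectation_row_form_mult cov_form_def expectation_four_rows_same[OF assms])

lemma expectation_row_form_distinct:
  assumes "v \<noteq> w" "v' \<noteq> w'" "{v, w} \<noteq> {v', w'}"
  shows "(\<integral>\<omega>. row_form K v w (B \<omega>) * row_form K' v' w' (B \<omega>) \<partial>P) = 0"
  by (simp add: expectation_row_form_mult expectation_four_rows_zero[OF assms])

end

section \<open>Both sides of the covariance identity as sums of \<open>cov_form\<close>\<close>

context random_environment
begin

lemma alpha_eq:
  "of_real (alpha adj P B b i j) = (\<Sum>v\<in>UNIV - {b}.
    cov_form (\<lambda>x y. of_real (walk_kernel adj i b v x y)) (\<lambda>x y. of_real (walk_kernel adj j b v x y)) b v)"
proof -
  have "of_real (alpha adj P B b i j) = (\<integral>\<omega>. (\<Sum>v\<in>UNIV - {b}.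
      complex_of_real (Y_coeff adj (B \<omega>) i b v) * of_real (Y_coeff adj (B \<omega>) j b v)) \<partial>P)"
    unfolding alpha_def by (simp flip: integral_complex_of_real)
  also have "\<dots> = (\<Sum>v\<in>UNIV - {b}. \<integral>\<omega>.
      complex_of_real (Y_coeff adj (B \<omega>) i b v) * of_real (Y_coeff adj (B \<omega>) j b v) \<partial>P)"
    unfolding Y_coeff_row_form by (intro Bochner_Integration.integral_sum row_form_mult_integrable)
  finally show ?thesis
    unfolding Y_coeff_row_form by (simp add: expectation_row_form_same)
qed

text \<open>Since \<open>cov_form\<close> is bilinear in its kernels, the double series moves inside
  finite sums, where it factors into the two single series that define the pair kernels.\<close>

lemma H_term_has_sum:
  assumes f: "f analytic_on cball 0 1" and g: "g analytic_on cball 0 1"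
  shows "(H_term adj P B b f g has_sum
    (\<Sum>v\<in>UNIV - {b}. cov_form (pair_kernel adj f b v) (pair_kernel adj g b v) b v)) UNIV"
proof -
  let ?a = "\<lambda>v p i. of_nat i * taylor f i * complex_of_real (walk_kernel adj i b v (fst p) (snd p))"
  let ?c = "\<lambda>v p j. of_nat j * taylor g j * complex_of_real (walk_kernel adj j b v (fst p) (snd p))"
  let ?C = "\<lambda>v p q. complex_of_real (cov b (fst p) (fst q) * cov v (snd p) (snd q))"
  have "((\<lambda>r. \<Sum>v\<in>UNIV - {b}. \<Sum>p\<in>UNIV. \<Sum>q\<in>UNIV. ?C v p q * (case r of (i, j) \<Rightarrow> ?a v p i * ?c v q j))
    has_sum (\<Sum>v\<in>UNIV - {b}. \<Sum>p\<in>UNIV. \<Sum>q\<in>UNIV. ?C v p q * ((\<Sum>i. ?a v p i) * (\<Sum>j. ?c v q j)))) UNIV"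
    by (intro has_sum_sum_functions has_sum_cmult_right has_sum_mult_product summable_pair_kernel f g)
  also have "(\<lambda>r. \<Sum>v\<in>UNIV - {b}. \<Sum>p\<in>UNIV. \<Sum>q\<in>UNIV. ?C v p q * (case r of (i, j) \<Rightarrow> ?a v p i * ?c v q j))
      = H_term adj P B b f g"
  proof (rule ext)
    fix r :: "nat \<times> nat"
    obtain i j where r: "r = (i, j)" by force
    have "H_term adj P B b f g r = of_nat i * of_nat j * taylor f i * taylor g j * of_real (alpha adj P B b i j)"
      by (simp add: H_term_def r)
    then show "(\<Sum>v\<in>UNIV - {b}. \<Sum>p\<in>UNIV. \<Sum>q\<in>UNIV. ?C v p q * (case r of (i, j) \<Rightarrow> ?a v p i * ?c v q j))
        = H_term adj P B b f g r"
      unfolding alpha_eq cov_form_def sum_distrib_left r prod.case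
      by (simp add: mult_ac)
  qed
  finally show ?thesis
    unfolding cov_form_def pair_kernel_def .
qed

text \<open>The terms with \<open>v = w\<close> vanish almost surely; leaving them out makes the moments exact sums.\<close>

definition limit_noise :: "(complex \<Rightarrow> complex) \<Rightarrow> 'w \<Rightarrow> complex" where
  "limit_noise f \<omega> = (\<Sum>(v, w)\<in>(SIGMA v:UNIV. UNIV - {v}). pair_form adj (B \<omega>) f v w)
    / of_real (2 * sqrt (real CARD('v)))"

lemma first_variation_AE: "AE \<omega> in P. first_variation (walk_matrix adj) (B \<omega>) f = 0"
  using stabilizer_sum by eventually_elim (simp add: first_variation_zero)

lemma spectral_noise_AE:
  assumes f: "f analytic_on cball 0 1"
  shows "AE \<omega> in P. spectral_noise adj (B \<omega>) f = limit_noise f \<omega>"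
  using stabilizer_sum
proof eventually_elim
  case (elim \<omega>)
  have "(\<Sum>v\<in>UNIV. \<Sum>w\<in>UNIV. pair_form adj (B \<omega>) f v w) = (\<Sum>v\<in>UNIV. \<Sum>w\<in>UNIV - {v}. pair_form adj (B \<omega>) f v w)"
    by (intro sum.cong[OF refl] sum.mono_neutral_right) (use elim in \<open>auto simp: pair_form_diagonal_zero[OF _ f]\<close>)
  also have "\<dots> = (\<Sum>(v, w)\<in>(SIGMA v:UNIV. UNIV - {v}). pair_form adj (B \<omega>) f v w)"
    by (simp add: sum.Sigma)
  finally show ?case
    using elim by (simp add: spectral_noise_eq[OF f] first_variation_zero second_variation_eq[OF f] limit_noise_def)
qed

lemma limit_noise_row_form:
  "limit_noise f \<omega> = (\<Sum>p\<in>(SIGMA v:UNIV. UNIV - {v}).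
      row_form (pair_kernel adj f (fst p) (snd p)) (fst p) (snd p) (B \<omega>)) / of_real (2 * sqrt (real CARD('v)))"
  by (simp add: limit_noise_def pair_form_row_form case_prod_unfold)

lemma limit_noise_integrable: "integrable P (limit_noise f)"
  unfolding limit_noise_row_form[abs_def]
  by (intro integrable_divide Bochner_Integration.integrable_sum row_form_integrable)

lemma limit_noise_mean: "(\<integral>\<omega>. limit_noise f \<omega> \<partial>P) = 0"
proof -
  have "(\<Sum>p\<in>(SIGMA v:UNIV. UNIV - {v}). \<integral>\<omega>. row_form (pair_kernel adj f (fst p) (snd p)) (fst p) (snd p) (B \<omega>) \<partial>P) = 0"
    by (intro sum.neutral ballI expectation_row_form) auto
  then show ?thesis
    unfolding limit_noise_row_form
    by (simp add: Bochner_Integration.integral_sum row_form_integrable del: of_real_mult)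
qed

lemma limit_noise_mult:
  "limit_noise f \<omega> * limit_noise g \<omega> = (\<Sum>p\<in>(SIGMA v:UNIV. UNIV - {v}). \<Sum>q\<in>(SIGMA v:UNIV. UNIV - {v}).
      row_form (pair_kernel adj f (fst p) (snd p)) (fst p) (snd p) (B \<omega>) *
      row_form (pair_kernel adj g (fst q) (snd q)) (fst q) (snd q) (B \<omega>)) / of_nat (4 * CARD('v))"
proof -
  have "complex_of_real (2 * sqrt (real CARD('v))) * of_real (2 * sqrt (real CARD('v))) = of_nat (4 * CARD('v))"
    unfolding of_real_mult[symmetric] by simp
  then show ?thesis
    unfolding limit_noise_row_form times_divide_times_eq sum_product by simp
qed

lemma limit_noise_mult_integrable: "integrable P (\<lambda>\<omega>. limit_noise f \<omega> * limit_noise g \<omega>)"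
  unfolding limit_noise_mult
  by (intro integrable_divide Bochner_Integration.integrable_sum row_form_mult_integrable)

text \<open>For a fixed ordered pair \<open>p\<close> only the partners \<open>p\<close> and
  \<open>prod.swap p\<close> survive, with equal contributions; \<open>2 / (4 * n)\<close> gives the
  denominator \<open>2 * n\<close>.\<close>

lemma limit_noise_covariance:
  assumes g: "g analytic_on cball 0 1"
  shows "(\<integral>\<omega>. limit_noise f \<omega> * limit_noise g \<omega> \<partial>P)
    = (\<Sum>v\<in>UNIV. \<Sum>w\<in>UNIV - {v}. cov_form (pair_kernel adj f v w) (pair_kernel adj g v w) v w) / of_nat (2 * CARD('v))"
proof -
  let ?D = "SIGMA v:UNIV. UNIV - {v::'v}"
  let ?R = "\<lambda>h p \<omega>. row_form (pair_kernel adj h (fst p) (snd p)) (fst p) (snd p) (B \<omega>)"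
  let ?G = "\<lambda>p. cov_form (pair_kernel adj f (fst p) (snd p)) (pair_kernel adj g (fst p) (snd p)) (fst p) (snd p)"
  \<comment> \<open>The kernels of a pair and of its reversal differ, but the forms agree for every
    realization; so the reversed partner reduces to the case of identical pairs.\<close>
  have swap: "?R g (prod.swap p) \<omega> = ?R g p \<omega>" for p \<omega>
    unfolding pair_form_row_form[symmetric] by (simp add: pair_form_commute[OF g, of adj _ "snd p"])
  have "(\<Sum>q\<in>?D. \<integral>\<omega>. ?R f p \<omega> * ?R g q \<omega> \<partial>P) = 2 * ?G p" if p: "p \<in> ?D" for p
  proof -
    have ne: "fst p \<noteq> snd p" using p by auto
    have "(\<Sum>q\<in>?D. \<integral>\<omega>. ?R f p \<omega> * ?R g q \<omega> \<partial>P) = (\<Sum>q\<in>{p, prod.swap p}. \<integral>\<omega>. ?R f p \<omega> * ?R g q \<omega> \<partial>P)"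
    proof (rule sum.mono_neutral_right)
      show "{p, prod.swap p} \<subseteq> ?D" using p by auto
      show "\<forall>q\<in>?D - {p, prod.swap p}. (\<integral>\<omega>. ?R f p \<omega> * ?R g q \<omega> \<partial>P) = 0"
      proof
        fix q assume q: "q \<in> ?D - {p, prod.swap p}"
        show "(\<integral>\<omega>. ?R f p \<omega> * ?R g q \<omega> \<partial>P) = 0"
          by (rule expectation_row_form_distinct[OF ne])
            (use q in \<open>auto simp: doubleton_eq_iff prod_eq_iff\<close>)
      qed
    qed simp
    also have "\<dots> = (\<integral>\<omega>. ?R f p \<omega> * ?R g p \<omega> \<partial>P) + (\<integral>\<omega>. ?R f p \<omega> * ?R g (prod.swap p) \<omega> \<partial>P)"
      using ne by (subst sum.insert) (auto simp: prod_eq_iff)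
    also have "\<dots> = 2 * ?G p"
      unfolding swap by (simp add: expectation_row_form_same[OF ne])
    finally show ?thesis .
  qed
  note inner = this
  have "(\<integral>\<omega>. limit_noise f \<omega> * limit_noise g \<omega> \<partial>P)
      = (\<integral>\<omega>. (\<Sum>p\<in>?D. \<Sum>q\<in>?D. ?R f p \<omega> * ?R g q \<omega>) \<partial>P) / of_nat (4 * CARD('v))"
    unfolding limit_noise_mult by (rule integral_divide_zero)
  also have "(\<integral>\<omega>. (\<Sum>p\<in>?D. \<Sum>q\<in>?D. ?R f p \<omega> * ?R g q \<omega>) \<partial>P)
      = (\<Sum>p\<in>?D. \<integral>\<omega>. (\<Sum>q\<in>?D. ?R f p \<omega> * ?R g q \<omega>) \<partial>P)"
    by (intro Bochner_Integration.integral_sum Bochner_Integration.integrable_sum row_form_mult_integrable)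
  also have "\<dots> = (\<Sum>p\<in>?D. \<Sum>q\<in>?D. \<integral>\<omega>. ?R f p \<omega> * ?R g q \<omega> \<partial>P)"
    by (intro sum.cong[OF refl] Bochner_Integration.integral_sum row_form_mult_integrable)
  also have "\<dots> = (\<Sum>p\<in>?D. 2 * ?G p)"
    by (rule sum.cong[OF refl inner])
  also have "\<dots> = 2 * (\<Sum>v\<in>UNIV. \<Sum>w\<in>UNIV - {v}. cov_form (pair_kernel adj f v w) (pair_kernel adj g v w) v w)"
    by (simp add: sum_distrib_left[symmetric] sum.Sigma case_prod_unfold)
  finally show ?thesis by simp
qed

text \<open>The summation variables are pairs of vertices, so the substitution is
  \<open>map_prod \<pi> \<pi>\<close>. The kernels are invariant under every automorphism, the row
  covariances under this particular \<open>\<pi>\<close>.\<close>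

lemma cov_form_automorphism:
  assumes \<pi>: "\<pi> \<in> automorphisms adj" and cov: "\<And>x y z. cov (\<pi> x) (\<pi> y) (\<pi> z) = cov x y z"
  shows "cov_form (pair_kernel adj f (\<pi> v) (\<pi> w)) (pair_kernel adj g (\<pi> v) (\<pi> w)) (\<pi> v) (\<pi> w)
    = cov_form (pair_kernel adj f v w) (pair_kernel adj g v w) v w"
proof -
  have "bij (map_prod \<pi> \<pi>)"
    using bij_automorphism[OF \<pi>] unfolding bij_def by (intro conjI prod.inj_map map_prod_surj) auto
  note reindex = sum.reindex_bij_betw[OF this, symmetric]
  show ?thesis
    unfolding cov_form_def
    by (subst reindex, rule sum.cong[OF refl], subst reindex)
      (simp add: pair_kernel_automorphism[OF \<pi>] cov)
qed

text \<open>As \<open>P\<close> may be incomplete, almost sure equality with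
  \<open>limit_noise\<close> does not yield measurability; it comes from the exact case formula,
  whose exceptional value is constant.\<close>

lemma spectral_noise_measurable:
  assumes f: "f analytic_on cball 0 1"
  shows "(\<lambda>\<omega>. spectral_noise adj (B \<omega>) f) \<in> borel_measurable P"
proof -
  have fst [measurable]: "(\<lambda>\<omega>. first_variation (walk_matrix adj) (B \<omega>) f) \<in> borel_measurable P"
    unfolding first_variation_def trace_pert_coeff_1
    unfolding trace_def matrix_matrix_mult_def
    by (intro borel_measurable_suminf) simp
  have snd [measurable]: "(\<lambda>\<omega>. second_variation (walk_matrix adj) (B \<omega>) f) \<in> borel_measurable P"
    unfolding second_variation_eq[OF f] pair_form_def by measurable
  show ?thesis unfolding spectral_noise_eq[OF f] by measurable
qed

lemma homogeneous_covariance_sum: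
  assumes "homogeneous_covariances adj P B"
  shows "(\<Sum>w\<in>UNIV - {v}. cov_form (pair_kernel adj f v w) (pair_kernel adj g v w) v w)
    = (\<Sum>w\<in>UNIV - {b}. cov_form (pair_kernel adj f b w) (pair_kernel adj g b w) b w)"
proof -
  obtain \<pi> where \<pi>: "\<pi> \<in> automorphisms adj" "\<pi> b = v" and cov: "\<And>x y z. cov (\<pi> x) (\<pi> y) (\<pi> z) = cov x y z"
    using assms unfolding homogeneous_covariances_def cov_def by meson
  have "bij_betw \<pi> (UNIV - {b}) (UNIV - {v})"
    using bij_betw_DiffI[of \<pi> UNIV UNIV "{b}" "{v}"] bij_automorphism[OF \<pi>(1)] \<pi>(2) by (simp add: bij_betw_def)
  then have "(\<Sum>w\<in>UNIV - {v}. cov_form (pair_kernel adj f v w) (pair_kernel adj g v w) v w)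
      = (\<Sum>w\<in>UNIV - {b}. cov_form (pair_kernel adj f v (\<pi> w)) (pair_kernel adj g v (\<pi> w)) v (\<pi> w))"
    by (rule sum.reindex_bij_betw[symmetric])
  then show ?thesis
    unfolding \<pi>(2)[symmetric] cov_form_automorphism[OF \<pi>(1) cov] .
qed

end

text \<open>Existence of the limit, integrability and absolute summability are stated alongside the
  identities because \<open>Lim\<close>, the integral and \<open>infsum\<close> return default
  values where these fail.\<close>

theorem theorem1:
  fixes adj :: "'v::finite \<Rightarrow> 'v \<Rightarrow> bool"
    and P :: "'w measure"
    and B :: "'w \<Rightarrow> real^'v^'v"
    and b :: 'v
    and f g :: "complex \<Rightarrow> complex"
  assumes env: "random_environment adj P B"
    and f: "f analytic_on cball 0 1"
    and g: "g analytic_on cball 0 1"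
  shows "(AE \<omega> in P. \<exists>l. (spectral_fluctuation adj (B \<omega>) f \<longlongrightarrow> l) (at 0)) \<and>
    integrable P (\<lambda>\<omega>. spectral_noise adj (B \<omega>) f) \<and>
    (\<integral>\<omega>. spectral_noise adj (B \<omega>) f \<partial>P) = 0 \<and>
    integrable P (\<lambda>\<omega>. spectral_noise adj (B \<omega>) f * spectral_noise adj (B \<omega>) g) \<and>
    (\<lambda>p. norm (H_term adj P B b f g p)) summable_on UNIV \<and>
    (homogeneous_covariances adj P B \<longrightarrow>
      (\<integral>\<omega>. spectral_noise adj (B \<omega>) f * spectral_noise adj (B \<omega>) g \<partial>P) = H_form adj P B b f g)"
proof -
  interpret random_environment adj P B by (rule env)
  note [measurable] = spectral_noise_measurable[OF f] spectral_noise_measurable[OF g]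
    borel_measurable_integrable[OF limit_noise_integrable]
  have AE_f: "AE \<omega> in P. spectral_noise adj (B \<omega>) f = limit_noise f \<omega>"
    by (rule spectral_noise_AE[OF f])
  have AE_fg: "AE \<omega> in P. spectral_noise adj (B \<omega>) f * spectral_noise adj (B \<omega>) g = limit_noise f \<omega> * limit_noise g \<omega>"
    using spectral_noise_AE[OF f] spectral_noise_AE[OF g] by eventually_elim simp
  have H: "H_form adj P B b f g = 1 / 2 * (\<Sum>v\<in>UNIV - {b}. cov_form (pair_kernel adj f b v) (pair_kernel adj g b v) b v)"
    unfolding H_form_def using infsumI[OF H_term_has_sum[OF f g]] by simp
  show ?thesis
  proof (intro conjI impI)
    show "AE \<omega> in P. \<exists>l. (spectral_fluctuation adj (B \<omega>) f \<longlongrightarrow> l) (at 0)"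
      using first_variation_AE by eventually_elim (use spectral_fluctuation_limit(1)[OF f] in blast)
    show "integrable P (\<lambda>\<omega>. spectral_noise adj (B \<omega>) f)"
      using limit_noise_integrable by (subst integrable_cong_AE[OF _ _ AE_f]) auto
    show "(\<integral>\<omega>. spectral_noise adj (B \<omega>) f \<partial>P) = 0"
      using limit_noise_mean by (subst integral_cong_AE[OF _ _ AE_f]) auto
    show "integrable P (\<lambda>\<omega>. spectral_noise adj (B \<omega>) f * spectral_noise adj (B \<omega>) g)"
      using limit_noise_mult_integrable by (subst integrable_cong_AE[OF _ _ AE_fg]) auto
    \<comment> \<open>For complex families unconditional and absolute summability coincide.\<close>
    show "(\<lambda>p. norm (H_term adj P B b f g p)) summable_on UNIV"
      using has_sum_imp_summable[OF H_term_has_sum[OF f g]] summable_on_iff_abs_summable_on_complex by blast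
    assume hom: "homogeneous_covariances adj P B"
    have "(\<integral>\<omega>. spectral_noise adj (B \<omega>) f * spectral_noise adj (B \<omega>) g \<partial>P) = (\<integral>\<omega>. limit_noise f \<omega> * limit_noise g \<omega> \<partial>P)"
      by (rule integral_cong_AE[OF _ _ AE_fg]) measurable
    \<comment> \<open>The inner sum no longer depends on \<open>v\<close>, so the outer sum only
      contributes the factor \<open>CARD('v)\<close> and leaves 1/2.\<close>
    also have "\<dots> = (\<Sum>v\<in>(UNIV :: 'v set). \<Sum>w\<in>UNIV - {b}. cov_form (pair_kernel adj f b w) (pair_kernel adj g b w) b w)
        / of_nat (2 * CARD('v))"
      unfolding limit_noise_covariance[OF g] 
      by (intro arg_cong2[of _ _ _ _ "(/)"] refl sum.cong homogeneous_covariance_sum hom)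
    finally show "(\<integral>\<omega>. spectral_noise adj (B \<omega>) f * spectral_noise adj (B \<omega>) g \<partial>P) = H_form adj P B b f g"
      by (simp add: H)
  qed
qed

end
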